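(* Suppose there exists a bounded non-decreasing function $r:[0,\infty]\to\mathbb{R}_+$ with $\lim_{h\searrow 0}r(h)=r(0)=0$ such that $$|U^i(s,t,\cdot)-U^i(s',t',\cdot)|\le r(|s-s'|+|t-t'|)\qquad\text{for all } s,t,s',t'\in[0,\infty],\ i=1,2.$$ Then for every $\epsilon>0$ the two-player non-zero-sum stopping game with payoffs $u^i(\rho,\tau)=\mathbb{E}[U^i(\rho[\tau],\tau[\rho])]$, $i=1,2$, $\rho,\tau\in\mathfrak{T}$, admits an $\epsilon$-Nash equilibrium, i.e. there exists $(\rho^*,\tau^* )\in\mathfrak{T}^2$ such that for all $\rho,\tau\in\mathfrak{T}$, $$u^1(\rho,\tau^* )\le u^1(\rho^*,\tau^* )+\epsilon\quad\text{and}\quad u^2(\rho^*,\tau)\le u^2(\rho^*,\tau^* )+\epsilon.$$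
   Context: $(\Omega,\mathcal{F},(\mathcal{F}_t)_{t\in[0,\infty]},\mathbb{P})$ is a filtered probability space whose filtration satisfies the usual conditions, with $\mathcal{F}=\mathcal{F}_\infty=\sigma(\bigcup_{t\in[0,\infty)}\mathcal{F}_t)$. $\Omega$ is at most countable and $\mathbb{P}$ is supported on $\Omega$ (every nonempty event has positive probability). $\mathcal{T}$ is the set of stopping times with values in $[0,\infty]$; for $\sigma\in\mathcal{T}$, $\mathcal{T}_\sigma$ (resp. $\mathcal{T}_{\sigma+}$) is the set of stopping times that are no less (resp. strictly greater) than $\sigma$. $\mathbb{T}$ is the set of maps $\phi:[0,\infty]\times\Omega\to[0,\infty]$ that are $\mathcal{B}([0,\infty])\otimes\mathcal{F}$-measurable and satisfy $\phi(t,\cdot)\in\mathcal{T}_{t+}$ for every $t\in[0,\infty)$. For $\sigma\in\mathcal{T}$ and $\phi\in\mathbb{T}$, $\phi(\sigma):=\phi(\sigma(\cdot),\cdot)$. A stopping strategy is a pair $\rho=(\rho_0,\rho_1)$ with $\rho_0\in\mathcal{T}$, $\rho_1\in\mathbb{T}$; $\mathfrak{T}$ is the set of stopping strategies. For $\rho=(\rho_0,\rho_1),\tau=(\tau_0,\tau_1)\in\mathfrak{T}$, $$\rho[\tau]:=\rho_0 1_{\{\rho_0\le\tau_0\}}+\rho_1(\tau_0)1_{\{\rho_0>\tau_0\}}$$ (with $0\cdot\infty=0$), and $\tau[\rho]$ is defined by exchanging the roles of $\rho$ and $\tau$. For $i=1,2$, $U^i:[0,\infty)\times[0,\infty)\times\Omega\to\mathbb{R}$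 is bounded, $U^i(s,t)=U^i(s,t,\cdot)$ is $\mathcal{F}_{s\vee t}$-measurable for all $s,t$, and for $s,t\in[0,\infty)$ the limits $U^i(s,\infty):=\lim_{b\to\infty}U^i(s,b)$, $U^i(\infty,t):=\lim_{a\to\infty}U^i(a,t)$, $U^i(\infty,\infty):=\lim_{a,b\to\infty}U^i(a,b)$ are assumed to exist; these extend $U^i$ to $[0,\infty]^2\times\Omega$. Convention: $|\infty-\infty|=0$. The game: $u^i(\rho,\tau)=\mathbb{E}[U^i(\rho[\tau],\tau[\rho])]=\mathbb{E}[U^i(\rho_0,\tau_1(\rho_0))1_{\{\rho_0<\tau_0\}}+U^i(\rho_1(\tau_0),\tau_0)1_{\{\rho_0>\tau_0\}}+U^i(\rho_0,\rho_0)1_{\{\rho_0=\tau_0\}}]$; player 1 chooses $\rho$ to maximize $u^1$ and player 2 chooses $\tau$ to maximize $u^2$. *)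

theory Defs
  imports "HOL-Probability.Probability"
begin

text \<open>
  Time is \<^typ>\<open>ennreal\<close>, i.e. all of $[0,\infty]$, so stopping times may be infinite and
  \<open>F \<infinity>\<close> is part of the filtration.
\<close>

locale countable_filtered_prob_space = prob_space M + filtration "space M" F
  for M :: "'a measure" and F :: "ennreal \<Rightarrow> 'a measure" +
  assumes sets_F_infinity: "sets (F \<infinity>) = sets M"
    and sets_eq_sigma: "sets M = sigma_sets (space M) (\<Union>t\<in>{..<\<infinity>}. sets (F t))"
    and right_continuous: "\<And>t. t < \<infinity> \<Longrightarrow> sets (F t) = (\<Inter>s\<in>{t<..}. sets (F s))"
    and complete: "\<And>A N. N \<in> null_sets M \<Longrightarrow> A \<subseteq> N \<Longrightarrow> A \<in> sets (F 0)"
    and countable_space: "countable (space M)"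
    and full_support: "\<And>A. A \<in> sets M \<Longrightarrow> A \<noteq> {} \<Longrightarrow> measure M A > 0"

definition stopping_times :: "(ennreal \<Rightarrow> 'a measure) \<Rightarrow> ('a \<Rightarrow> ennreal) set" where
  "stopping_times F = {\<tau>. stopping_time F \<tau>}"

definition stopping_times_after ::
    "'a measure \<Rightarrow> (ennreal \<Rightarrow> 'a measure) \<Rightarrow> ('a \<Rightarrow> ennreal) \<Rightarrow> ('a \<Rightarrow> ennreal) set" where
  "stopping_times_after M F \<sigma> = {\<tau> \<in> stopping_times F. \<forall>\<omega>\<in>space M. \<sigma> \<omega> < \<tau> \<omega>}"

text \<open>The set $\mathbb{T}$: \<open>\<phi> t\<close> is the reaction to the opponent having stopped at time \<open>t\<close>.\<close>

definition reaction_maps ::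
    "'a measure \<Rightarrow> (ennreal \<Rightarrow> 'a measure) \<Rightarrow> (ennreal \<Rightarrow> 'a \<Rightarrow> ennreal) set" where
  "reaction_maps M F =
     {\<phi>. (\<lambda>(t, \<omega>). \<phi> t \<omega>) \<in> borel_measurable (borel \<Otimes>\<^sub>M M) \<and>
         (\<forall>t<\<infinity>. \<phi> t \<in> stopping_times_after M F (\<lambda>_. t))}"

type_synonym 'a strategy = "('a \<Rightarrow> ennreal) \<times> (ennreal \<Rightarrow> 'a \<Rightarrow> ennreal)"

definition stopping_strategies ::
    "'a measure \<Rightarrow> (ennreal \<Rightarrow> 'a measure) \<Rightarrow> 'a strategy set" where
  "stopping_strategies M F = stopping_times F \<times> reaction_maps M F"

text \<open>
  \<open>realized \<rho> \<tau>\<close> is $\rho[\tau]$, the time at which the player using \<open>\<rho>\<close> stops against \<open>\<tau>\<close>.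
  The convention $0\cdot\infty = 0$ holds in \<^typ>\<open>ennreal\<close>.
\<close>

definition realized :: "'a strategy \<Rightarrow> 'a strategy \<Rightarrow> 'a \<Rightarrow> ennreal" where
  "realized \<rho> \<tau> \<omega> =
     fst \<rho> \<omega> * indicator {\<omega>. fst \<rho> \<omega> \<le> fst \<tau> \<omega>} \<omega> +
     snd \<rho> (fst \<tau> \<omega>) \<omega> * indicator {\<omega>. fst \<rho> \<omega> > fst \<tau> \<omega>} \<omega>"

text \<open>
  The reward is given on $[0,\infty)^2\times\Omega$ and extended to $[0,\infty]^2\times\Omega$ by
  its limits; below \<open>U\<close> is the extended function. The limits run over finite times only
  (\<open>at_left \<infinity>\<close>), and in the last one both times tend to infinity jointly.
\<close>

definition reward_process ::
    "'a measure \<Rightarrow> (ennreal \<Rightarrow> 'a measure) \<Rightarrow> (ennreal \<Rightarrow> ennreal \<Rightarrow> 'a \<Rightarrow> real) \<Rightarrow> bool" where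
  "reward_process M F U \<longleftrightarrow>
     (\<exists>B. \<forall>s<\<infinity>. \<forall>t<\<infinity>. \<forall>\<omega>\<in>space M. \<bar>U s t \<omega>\<bar> \<le> B) \<and>
     (\<forall>s<\<infinity>. \<forall>t<\<infinity>. U s t \<in> borel_measurable (F (max s t))) \<and>
     (\<forall>\<omega>\<in>space M.
        (\<forall>s<\<infinity>. ((\<lambda>b. U s b \<omega>) \<longlongrightarrow> U s \<infinity> \<omega>) (at_left \<infinity>)) \<and>
        (\<forall>t<\<infinity>. ((\<lambda>a. U a t \<omega>) \<longlongrightarrow> U \<infinity> t \<omega>) (at_left \<infinity>)) \<and>
        ((\<lambda>(a, b). U a b \<omega>) \<longlongrightarrow> U \<infinity> \<infinity> \<omega>) (at_left \<infinity> \<times>\<^sub>F at_left \<infinity>))"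

definition payoff ::
    "'a measure \<Rightarrow> (ennreal \<Rightarrow> ennreal \<Rightarrow> 'a \<Rightarrow> real) \<Rightarrow> 'a strategy \<Rightarrow> 'a strategy \<Rightarrow> real" where
  "payoff M U \<rho> \<tau> = (LINT \<omega>|M. U (realized \<rho> \<tau> \<omega>) (realized \<tau> \<rho> \<omega>) \<omega>)"

text \<open>
  $|s-t|$ on $[0,\infty]$ with $|\infty-\infty| = 0$. The case distinction is needed because
  \<open>\<infinity> - \<infinity> = \<infinity>\<close> in \<^typ>\<open>ennreal\<close>.
\<close>

definition time_dist :: "ennreal \<Rightarrow> ennreal \<Rightarrow> ennreal" where
  "time_dist s t = (if s = t then 0 else max s t - min s t)"

end

(*
  A game tree with finitely many stages has a pure equilibrium: going backwards, stop the first
  player when this beats her continuation value, otherwise stop the second player when this beats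
  his, otherwise nobody; the player who does not stop only reacts, and her reaction is at least as
  good as stopping simultaneously.

  To reduce to this case, keep finitely many atoms carrying almost all of the mass. Any two of them
  are separated by the filtration at a definite time, by right continuity at that very time. Choose
  a finite grid of times that contains 0, infinity and all these separation times and is so fine
  that the rewards are almost constant on each cell. As no information arrives inside a cell,
  stopping times can be rounded down to the grid, so that a player who stops inside a cell could
  have stopped at its left endpoint. Hence pre-empting an opponent who stops at the next grid point
  gains nothing over stopping at the previous one. Reactions to a stop inside a cell start at the right
  endpoint of the cell, which makes them strictly later and jointly measurable.
*)

theory Submission
  imports Defs
begin

section \<open>Stopping games on a finite tree\<close>

text \<open>Once one player has stopped, the other faces a one-person optimal stopping problem. Both
  reactions can therefore be fixed before the game over the first stops is solved, and what is left
  of them is a reward \<open>X\<close> for stopping first and a reward \<open>Y\<close> for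
  reacting. The obstacle is the simultaneous stop, a third outcome that can leave a stopping game
  without a pure equilibrium. \<open>stopper_reward\<close> removes it by paying a tie as a
  reaction. This is harmless: stopping together at one grid point pays almost the same as reacting
  at the next one, and the fixed reaction is at least as good as that. In the equilibrium itself no
  tie occurs before \<infinity>, so apart from the discarded mass its payoff is exact and only
  deviations are estimated. Optimality is always asserted on every event known at the stage in
  question, because a stop of the opponent singles out such an event. Sums weighted by masses take
  the place of conditional expectations.\<close>

definition stopper_reward :: "(nat \<Rightarrow> 'a \<Rightarrow> real) \<Rightarrow> (nat \<Rightarrow> 'a \<Rightarrow> real) \<Rightarrow> nat \<Rightarrow> nat \<Rightarrow> 'a \<Rightarrow> real" where
  "stopper_reward X Y a b x = (if a < b then X a x else Y b x)"

section \<open>Stopping times for a finite filtration given by partitions\<close>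

locale finite_filtration =
  fixes W :: "'a set" and cl :: "nat \<Rightarrow> 'a \<Rightarrow> 'a set" and N :: nat
  assumes finite_W: "finite W"
    and cl_self: "x \<in> W \<Longrightarrow> x \<in> cl k x"
    and cl_subset: "x \<in> W \<Longrightarrow> cl k x \<subseteq> W"
    and cl_eq: "x \<in> W \<Longrightarrow> y \<in> cl k x \<Longrightarrow> cl k y = cl k x"
    and cl_antimono: "x \<in> W \<Longrightarrow> i \<le> j \<Longrightarrow> cl j x \<subseteq> cl i x"
begin

text \<open>Stopping times with values in {m..N}: on \<open>W\<close>, each event {\<kappa> = k} is
  a union of classes of stage \<open>k\<close>.\<close>

definition adapted :: "nat \<Rightarrow> ('a \<Rightarrow> nat) \<Rightarrow> bool" where
  "adapted m \<kappa> \<longleftrightarrow> (\<forall>x\<in>W. m \<le> \<kappa> x \<and> \<kappa> x \<le> N \<and> (\<forall>y\<in>cl (\<kappa> x) x. \<kappa> y = \<kappa> x))"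

text \<open>The events of stage \<open>k\<close>.\<close>

definition saturated :: "nat \<Rightarrow> 'a set \<Rightarrow> bool" where
  "saturated k C \<longleftrightarrow> C \<subseteq> W \<and> (\<forall>x\<in>C. cl k x \<subseteq> C)"

lemma adapted_bounds: "adapted m \<kappa> \<Longrightarrow> x \<in> W \<Longrightarrow> m \<le> \<kappa> x" "adapted m \<kappa> \<Longrightarrow> x \<in> W \<Longrightarrow> \<kappa> x \<le> N"
  by (auto simp: adapted_def)

lemma adapted_eq:
  assumes "adapted m \<kappa>" "x \<in> W" "\<kappa> x \<le> k" "y \<in> cl k x"
  shows "\<kappa> y = \<kappa> x"
  using assms cl_antimono[of x "\<kappa> x" k] by (auto simp: adapted_def)

lemma adapted_const: "m \<le> k \<Longrightarrow> k \<le> N \<Longrightarrow> adapted m (\<lambda>_. k)"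
  by (auto simp: adapted_def)

lemma adapted_max:
  assumes "adapted m \<kappa>" "k \<le> N"
  shows "adapted k (\<lambda>x. max k (\<kappa> x))"
  unfolding adapted_def
proof (intro ballI conjI)
  fix x y assume x: "x \<in> W" and y: "y \<in> cl (max k (\<kappa> x)) x"
  show "max k (\<kappa> y) = max k (\<kappa> x)"
    using adapted_eq[OF assms(1) x _ y] by simp
qed (use assms in \<open>auto simp: adapted_def\<close>)

lemma cl_sym:
  assumes "x \<in> W" "y \<in> cl k x"
  shows "y \<in> W" "x \<in> cl k y"
  using assms cl_subset cl_eq[OF assms] cl_self[OF assms(1)] by auto

text \<open>Membership in \<open>C\<close> is settled at stage \<open>k\<close>, no later than
  either time can stop, so switching on \<open>C\<close> uses no future information.\<close>

lemma adapted_paste: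
  assumes "adapted m \<kappa>" "adapted m \<kappa>'" "k \<le> m" "saturated k C"
  shows "adapted m (\<lambda>x. if x \<in> C then \<kappa>' x else \<kappa> x)"
  unfolding adapted_def
proof (intro ballI conjI)
  fix x assume x: "x \<in> W"
  fix y assume y: "y \<in> cl (if x \<in> C then \<kappa>' x else \<kappa> x) x"
  have "y \<in> cl k x"
  proof -
    have "k \<le> (if x \<in> C then \<kappa>' x else \<kappa> x)"
      using adapted_bounds(1)[OF assms(1) x] adapted_bounds(1)[OF assms(2) x] assms(3) by simp
    from cl_antimono[OF x this] show ?thesis using y by blast
  qed
  then have "y \<in> C \<longleftrightarrow> x \<in> C"
    using cl_sym[OF x, of y k] assms(4) by (auto simp: saturated_def)
  then show "(if y \<in> C then \<kappa>' y else \<kappa> y) = (if x \<in> C then \<kappa>' x else \<kappa> x)"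
    using y assms(1,2) x by (auto simp: adapted_def)
qed (use assms in \<open>auto simp: adapted_def\<close>)

lemma saturated_cl: "x \<in> W \<Longrightarrow> k \<le> m \<Longrightarrow> saturated m (cl k x)"
  unfolding saturated_def
  by (metis cl_antimono cl_eq cl_subset subsetD subsetI)

lemma sum_mono_saturated:
  fixes f h :: "'a \<Rightarrow> real"
  assumes "saturated k C" and le: "\<And>x. x \<in> C \<Longrightarrow> sum f (cl k x) \<le> sum h (cl k x)"
  shows "sum f C \<le> sum h C"
proof -
  have CW: "C \<subseteq> W" and fin: "finite C"
    using assms(1) finite_W by (auto simp: saturated_def intro: finite_subset)
  have fib: "{y \<in> C. cl k y = cl k x} = cl k x" if "x \<in> C" for x
  proof -
    have "x \<in> W" using that CW by auto
    moreover have "cl k x \<subseteq> C" using that assms(1) by (simp add: saturated_def)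
    ultimately show ?thesis using cl_eq[of x] cl_self CW by blast
  qed
  have group: "sum q C = (\<Sum>c\<in>cl k ` C. sum q c)" for q :: "'a \<Rightarrow> real"
  proof -
    have "sum q C = (\<Sum>c\<in>cl k ` C. sum q {y \<in> C. cl k y = c})"
      by (rule sum.group[symmetric]) (simp_all add: fin)
    also have "\<dots> = (\<Sum>c\<in>cl k ` C. sum q c)"
      by (rule sum.cong) (auto simp only: fib)
    finally show ?thesis .
  qed
  have "(\<Sum>c\<in>cl k ` C. sum f c) \<le> (\<Sum>c\<in>cl k ` C. sum h c)"
    using le by (intro sum_mono[where K = "cl k ` C"]) blast
  then show ?thesis by (simp only: group)
qed

text \<open>A maximiser of the total over \<open>W\<close> is automatically optimal on every event
  known by stage \<open>m\<close>: a better time on \<open>C\<close> could be pasted in and would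
  raise the total.\<close>

lemma optimal_adapted:
  fixes f :: "nat \<Rightarrow> 'a \<Rightarrow> real"
  assumes "m \<le> N"
  shows "\<exists>\<kappa>. adapted m \<kappa> \<and> (\<forall>k C \<kappa>'. k \<le> m \<longrightarrow> saturated k C \<longrightarrow> adapted m \<kappa>' \<longrightarrow>
    (\<Sum>x\<in>C. f (\<kappa>' x) x) \<le> (\<Sum>x\<in>C. f (\<kappa> x) x))"
proof -
  define v where "v \<kappa> = (\<Sum>x\<in>W. f (\<kappa> x) x)" for \<kappa>
  \<comment> \<open>Adapted times are unrestricted off \<open>W\<close> and may be infinitely many;
    it is their set of values that is finite.\<close>
  have "v ` {\<kappa>. adapted m \<kappa>} \<subseteq> v ` (W \<rightarrow>\<^sub>E {..N})"
  proof (rule image_subsetI)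
    fix \<kappa> assume "\<kappa> \<in> {\<kappa>. adapted m \<kappa>}"
    then have "restrict \<kappa> W \<in> W \<rightarrow>\<^sub>E {..N}" by (auto simp: adapted_def)
    moreover have "v \<kappa> = v (restrict \<kappa> W)" unfolding v_def by (intro sum.cong) auto
    ultimately show "v \<kappa> \<in> v ` (W \<rightarrow>\<^sub>E {..N})" by blast
  qed
  then have fin: "finite (v ` {\<kappa>. adapted m \<kappa>})"
    using finite_W by (meson finite_PiE finite_atMost finite_imageI finite_subset)
  have "v ` {\<kappa>. adapted m \<kappa>} \<noteq> {}" using adapted_const[of m m] assms by auto
  from Max_in[OF fin this] obtain \<kappa>
    where \<kappa>: "adapted m \<kappa>" "v \<kappa> = Max (v ` {\<kappa>. adapted m \<kappa>})" by auto
  have max: "v \<kappa>' \<le> v \<kappa>" if "adapted m \<kappa>'" for \<kappa>'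
    unfolding \<kappa>(2) using fin that by (intro Max_ge) auto
  show ?thesis
  proof (intro exI conjI allI impI)
    show "adapted m \<kappa>" by (rule \<kappa>(1))
    fix k C \<kappa>' assume k: "k \<le> m" and C: "saturated k C" and \<kappa>': "adapted m \<kappa>'"
    have split: "v q = (\<Sum>x\<in>C. f (q x) x) + (\<Sum>x\<in>W - C. f (q x) x)" for q
      unfolding v_def using C finite_W by (subst sum.subset_diff[of C]) (auto simp: saturated_def)
    have "v (\<lambda>x. if x \<in> C then \<kappa>' x else \<kappa> x) \<le> v \<kappa>"
      by (rule max[OF adapted_paste[OF \<kappa>(1) \<kappa>' k C]])
    then show "(\<Sum>x\<in>C. f (\<kappa>' x) x) \<le> (\<Sum>x\<in>C. f (\<kappa> x) x)"
      unfolding split by simp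
  qed
qed

section \<open>Backward induction over the stages\<close>

definition best_against :: "(nat \<Rightarrow> 'a \<Rightarrow> real) \<Rightarrow> (nat \<Rightarrow> 'a \<Rightarrow> real) \<Rightarrow> nat \<Rightarrow> ('a \<Rightarrow> nat) \<Rightarrow> ('a \<Rightarrow> nat) \<Rightarrow> bool" where
  "best_against X Y k \<alpha> \<beta> \<longleftrightarrow>
     (\<forall>C \<alpha>'. saturated k C \<longrightarrow> adapted k \<alpha>' \<longrightarrow>
        (\<Sum>x\<in>C. stopper_reward X Y (\<alpha>' x) (\<beta> x) x) \<le> (\<Sum>x\<in>C. stopper_reward X Y (\<alpha> x) (\<beta> x) x))"

text \<open>\<open>P\<close> is where the player stops at \<open>k\<close>, \<open>Q\<close> where
  the opponent does. On a class in \<open>Q\<close> her choice has no effect, because a tie at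
  \<open>k\<close> is paid as a reaction too. On any other class an adapted deviation either stops
  at \<open>k\<close> on the whole class or continues on the whole class; in the second case the
  optimality at \<open>Suc k\<close> bounds it, since a class of stage \<open>k\<close> is an event
  of stage \<open>Suc k\<close>. \<open>P1\<close> and \<open>P2\<close> say that \<open>P\<close>
  selects the larger of the two values.\<close>

lemma best_against_step:
  assumes k: "Suc k \<le> N"
    and \<alpha>: "adapted (Suc k) \<alpha>" and \<beta>: "adapted (Suc k) \<beta>"
    and best: "best_against X Y (Suc k) \<alpha> \<beta>"
    and P: "\<And>x y. x \<in> W \<Longrightarrow> y \<in> cl k x \<Longrightarrow> P y = P x"
    and Q: "\<And>x y. x \<in> W \<Longrightarrow> y \<in> cl k x \<Longrightarrow> Q y = Q x"
    and PQ: "\<And>x. x \<in> W \<Longrightarrow> \<not> (P x \<and> Q x)"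
    and P1: "\<And>x. x \<in> W \<Longrightarrow> P x \<Longrightarrow>
       (\<Sum>y\<in>cl k x. stopper_reward X Y (\<alpha> y) (\<beta> y) y) \<le> (\<Sum>y\<in>cl k x. X k y)"
    and P2: "\<And>x. x \<in> W \<Longrightarrow> \<not> P x \<Longrightarrow> \<not> Q x \<Longrightarrow>
       (\<Sum>y\<in>cl k x. X k y) \<le> (\<Sum>y\<in>cl k x. stopper_reward X Y (\<alpha> y) (\<beta> y) y)"
  shows "best_against X Y k (\<lambda>x. if P x then k else \<alpha> x) (\<lambda>x. if Q x then k else \<beta> x)"
  unfolding best_against_def
proof (intro allI impI)
  let ?\<alpha> = "\<lambda>x. if P x then k else \<alpha> x" and ?\<beta> = "\<lambda>x. if Q x then k else \<beta> x"
  fix C \<alpha>' assume C: "saturated k C" and \<alpha>': "adapted k \<alpha>'"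
  show "(\<Sum>x\<in>C. stopper_reward X Y (\<alpha>' x) (?\<beta> x) x) \<le> (\<Sum>x\<in>C. stopper_reward X Y (?\<alpha> x) (?\<beta> x) x)"
  proof (rule sum_mono_saturated[OF C])
    fix x assume "x \<in> C"
    then have x: "x \<in> W" using C by (auto simp: saturated_def)
    have cW: "y \<in> W" if "y \<in> cl k x" for y using that cl_subset[OF x] by auto
    have gt: "k < \<alpha> y" "k < \<beta> y" if "y \<in> cl k x" for y
      using adapted_bounds(1)[OF \<alpha>] adapted_bounds(1)[OF \<beta>] cW[OF that] by (simp_all add: Suc_le_eq)
    show "(\<Sum>x\<in>cl k x. stopper_reward X Y (\<alpha>' x) (?\<beta> x) x) \<le> (\<Sum>x\<in>cl k x. stopper_reward X Y (?\<alpha> x) (?\<beta> x) x)"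
    proof (cases "Q x")
      case True
      have "stopper_reward X Y (\<alpha>' y) (?\<beta> y) y = stopper_reward X Y (?\<alpha> y) (?\<beta> y) y" if "y \<in> cl k x" for y
        using True Q[OF x that] PQ[OF cW[OF that]] gt[OF that] adapted_bounds(1)[OF \<alpha>' cW[OF that]]
        by (simp add: stopper_reward_def)
      then show ?thesis by (simp cong: sum.cong)
    next
      case False
      let ?v = "\<Sum>y\<in>cl k x. stopper_reward X Y (\<alpha> y) (\<beta> y) y"
      have R: "(\<Sum>y\<in>cl k x. stopper_reward X Y (?\<alpha> y) (?\<beta> y) y) = (if P x then (\<Sum>y\<in>cl k x. X k y) else ?v)"
        using False Q[OF x] P[OF x] gt by (auto simp: stopper_reward_def intro!: sum.cong)
      have "(\<Sum>y\<in>cl k x. stopper_reward X Y (\<alpha>' y) (?\<beta> y) y) = (\<Sum>y\<in>cl k x. X k y) \<or>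
            (\<Sum>y\<in>cl k x. stopper_reward X Y (\<alpha>' y) (?\<beta> y) y) \<le> ?v"
      proof (cases "\<alpha>' x = k")
        case True
        have "\<alpha>' y = k" if "y \<in> cl k x" for y
          using adapted_eq[OF \<alpha>' x _ that] True by simp
        then show ?thesis using False Q[OF x] gt
          by (auto simp: stopper_reward_def intro!: sum.cong disjI1)
      next
        case neq: False
        have gt': "k < \<alpha>' y" if "y \<in> cl k x" for y
        proof -
          have "\<alpha>' y \<noteq> k"
            using adapted_eq[OF \<alpha>' cW[OF that], of k x] cl_sym[OF x that] neq by auto
          then show ?thesis using adapted_bounds(1)[OF \<alpha>' cW[OF that]] by simp
        qed
        \<comment> \<open>Off this class \<alpha>' may stop at \<open>k\<close>. The maximum makes
          it adapted from \<open>Suc k\<close> on everywhere without changing it on the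
          class.\<close>
        have "(\<Sum>y\<in>cl k x. stopper_reward X Y (\<alpha>' y) (?\<beta> y) y)
            = (\<Sum>y\<in>cl k x. stopper_reward X Y (max (Suc k) (\<alpha>' y)) (\<beta> y) y)"
          using False Q[OF x] gt' by (intro sum.cong) (simp_all add: max_absorb2 Suc_le_eq)
        also have "\<dots> \<le> ?v"
          using best saturated_cl[OF x, of k "Suc k"] adapted_max[OF \<alpha>' k]
          by (auto simp: best_against_def)
        finally show ?thesis by blast
      qed
      then show ?thesis unfolding R using P1[OF x] P2[OF x _ False] by (auto split: if_splits)
    qed
  qed
qed

lemma adapted_override:
  assumes k: "Suc k \<le> N" and \<alpha>: "adapted (Suc k) \<alpha>"
    and P: "\<And>x y. x \<in> W \<Longrightarrow> y \<in> cl k x \<Longrightarrow> P y = P x"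
  shows "adapted k (\<lambda>x. if P x then k else \<alpha> x)"
proof -
  have "adapted k (\<lambda>x. if x \<in> {x \<in> W. P x} then k else \<alpha> x)"
  proof (rule adapted_paste[of k _ _ k])
    show "adapted k \<alpha>" using \<alpha> by (auto simp: adapted_def)
    show "saturated k {x \<in> W. P x}"
      using P cl_sym(1) by (auto simp: saturated_def)
  qed (use k in \<open>auto intro: adapted_const\<close>)
  moreover have "y \<in> W" if "x \<in> W" "y \<in> cl j x" for x y j
    using cl_sym(1) that by blast
  ultimately show ?thesis by (simp add: adapted_def)
qed

text \<open>Player 1 decides first at every stage, and player 2 stops only where player 1 does not, so no
  order between \<open>X\<close> and \<open>Y\<close> is needed. A deviation to a simultaneous stop is valued by
  \<^const>\<open>stopper_reward\<close> as a reaction.\<close>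

lemma discrete_equilibrium:
  assumes "k \<le> N"
  shows "\<exists>\<alpha> \<beta>. adapted k \<alpha> \<and> adapted k \<beta> \<and> (\<forall>x\<in>W. \<alpha> x = \<beta> x \<longrightarrow> \<alpha> x = N) \<and>
    best_against X1 Y1 k \<alpha> \<beta> \<and> best_against X2 Y2 k \<beta> \<alpha>"
  using assms
proof (induction rule: inc_induct)
  case base
  have "best_against X Y N (\<lambda>_. N) (\<lambda>_. N)" for X Y
    unfolding best_against_def
  proof (intro allI impI sum_mono)
    fix C \<alpha>' x assume "saturated N C" "adapted N \<alpha>'" "x \<in> C"
    then have "\<alpha>' x = N" by (meson adapted_bounds le_antisym saturated_def subsetD)
    then show "stopper_reward X Y (\<alpha>' x) N x \<le> stopper_reward X Y N N x" by simp
  qed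
  then show ?case using adapted_const[of N N] by blast
next
  case (step k)
  then have k: "Suc k \<le> N" by simp
  from step obtain \<alpha> \<beta> where \<alpha>: "adapted (Suc k) \<alpha>" and \<beta>: "adapted (Suc k) \<beta>"
    and tie: "\<And>x. x \<in> W \<Longrightarrow> \<alpha> x = \<beta> x \<Longrightarrow> \<alpha> x = N"
    and best: "best_against X1 Y1 (Suc k) \<alpha> \<beta>" "best_against X2 Y2 (Suc k) \<beta> \<alpha>"
    by blast
  define P where "P x \<longleftrightarrow> (\<Sum>y\<in>cl k x. stopper_reward X1 Y1 (\<alpha> y) (\<beta> y) y) \<le> (\<Sum>y\<in>cl k x. X1 k y)" for x
  define Q where "Q x \<longleftrightarrow> \<not> P x \<and>
    (\<Sum>y\<in>cl k x. stopper_reward X2 Y2 (\<beta> y) (\<alpha> y) y) \<le> (\<Sum>y\<in>cl k x. X2 k y)" for x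
  have P: "P y = P x" and Q: "Q y = Q x" if "x \<in> W" "y \<in> cl k x" for x y
    using cl_eq[OF that] by (simp_all add: P_def Q_def)
  have tie': "(if P x then k else \<alpha> x) = (if Q x then k else \<beta> x) \<longrightarrow> (if P x then k else \<alpha> x) = N"
    if "x \<in> W" for x
    using tie[OF that] adapted_bounds(1)[OF \<alpha> that] adapted_bounds(1)[OF \<beta> that]
    by (auto simp: Q_def)
  show ?case
  proof (intro exI conjI)
    show "adapted k (\<lambda>x. if P x then k else \<alpha> x)"
      by (rule adapted_override[OF k \<alpha> P])
    show "adapted k (\<lambda>x. if Q x then k else \<beta> x)"
      by (rule adapted_override[OF k \<beta> Q])
    show "\<forall>x\<in>W. (if P x then k else \<alpha> x) = (if Q x then k else \<beta> x) \<longrightarrow> (if P x then k else \<alpha> x) = N"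
      using tie' by blast
    show "best_against X1 Y1 k (\<lambda>x. if P x then k else \<alpha> x) (\<lambda>x. if Q x then k else \<beta> x)"
      by (rule best_against_step[OF k \<alpha> \<beta> best(1) P Q]) (auto simp: P_def Q_def)
    show "best_against X2 Y2 k (\<lambda>x. if Q x then k else \<beta> x) (\<lambda>x. if P x then k else \<alpha> x)"
      by (rule best_against_step[OF k \<beta> \<alpha> best(2) Q P]) (auto simp: Q_def)
  qed
qed

end

section \<open>Sigma-algebras on a countable space as equivalence relations\<close>

definition indist :: "'a measure \<Rightarrow> 'a \<Rightarrow> 'a \<Rightarrow> bool" where
  "indist N x y \<longleftrightarrow> (\<forall>A\<in>sets N. x \<in> A \<longleftrightarrow> y \<in> A)"

lemma indist_refl [simp]: "indist N x x"
  by (simp add: indist_def)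

lemma indist_sym: "indist N x y \<Longrightarrow> indist N y x"
  by (simp add: indist_def)

lemma indist_trans: "indist N x y \<Longrightarrow> indist N y z \<Longrightarrow> indist N x z"
  by (simp add: indist_def)

lemma indist_mono: "sets N \<subseteq> sets N' \<Longrightarrow> indist N' x y \<Longrightarrow> indist N x y"
  by (auto simp: indist_def)

text \<open>Countability enters twice: \<open>A\<close> is the union over its points
  \<open>x\<close> of the intersections, over the points \<open>y\<close> outside \<open>A\<close>,
  of measurable sets that contain \<open>x\<close> but not \<open>y\<close>. A sigma-algebra on a
  countable space is thus determined by its indistinguishability relation.\<close>

lemma sets_if_indist_closed:
  assumes "countable (space N)" "A \<subseteq> space N"
    and closed: "\<And>x y. x \<in> A \<Longrightarrow> y \<in> space N \<Longrightarrow> indist N x y \<Longrightarrow> y \<in> A"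
  shows "A \<in> sets N"
proof -
  have "\<exists>D. D \<in> sets N \<and> (x \<in> A \<longrightarrow> y \<in> space N - A \<longrightarrow> x \<in> D \<and> y \<notin> D)" for x y
  proof (cases "x \<in> A \<and> y \<in> space N - A")
    case True
    then obtain D where D: "D \<in> sets N" "x \<in> D \<longleftrightarrow> y \<notin> D"
      using closed[of x y] by (auto simp: indist_def)
    have "x \<in> space N" using True assms(2) by auto
    show ?thesis
    proof (cases "x \<in> D")
      case True
      then show ?thesis using D by auto
    next
      case False
      then have "space N - D \<in> sets N \<and> x \<in> space N - D \<and> y \<notin> space N - D"
        using D \<open>x \<in> space N\<close> by auto
      then show ?thesis by blast
    qed
  qed auto
  then obtain D where sets_D: "\<And>x y. D x y \<in> sets N"
    and D: "\<And>x y. x \<in> A \<Longrightarrow> y \<in> space N - A \<Longrightarrow> x \<in> D x y \<and> y \<notin> D x y"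
    by metis
  have eq: "A = (\<Union>x\<in>A. {z \<in> space N. \<forall>y\<in>space N - A. z \<in> D x y})"
    using D assms(2) by blast
  have "(\<Union>x\<in>A. {z \<in> space N. \<forall>y\<in>space N - A. z \<in> D x y}) \<in> sets N"
  proof (rule sets.countable_UN''[OF countable_subset[OF assms(2,1)]])
    fix x assume "x \<in> A"
    have "{z \<in> space N. z \<in> D x y} \<in> sets N" for y
      using sets_D[of x y] sets.Int_space_eq1[OF sets_D, of x y] by (simp add: Int_def)
    then show "{z \<in> space N. \<forall>y\<in>space N - A. z \<in> D x y} \<in> sets N"
      by (intro sets.sets_Collect_countable_All' countable_subset[OF Diff_subset assms(1)])
  qed
  then show ?thesis using eq by simp
qed

lemma measurable_if_indist_invariant:
  assumes "countable (space N)"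
    and "\<And>x y. x \<in> space N \<Longrightarrow> y \<in> space N \<Longrightarrow> indist N x y \<Longrightarrow> f y = f x"
  shows "f \<in> borel_measurable N"
proof (rule measurableI)
  fix A
  show "f -` A \<inter> space N \<in> sets N"
  proof (rule sets_if_indist_closed[OF assms(1)])
    show "y \<in> f -` A \<inter> space N" if "x \<in> f -` A \<inter> space N" "y \<in> space N" "indist N x y" for x y
      using assms(2)[of x y] that by simp
  qed simp
qed simp

lemma indist_measurable_eq:
  fixes f :: "'a \<Rightarrow> 'b::t1_space"
  assumes "f \<in> borel_measurable N" "x \<in> space N" "indist N x y" "y \<in> space N"
  shows "f y = f x"
proof -
  have "f -` {f x} \<inter> space N \<in> sets N"
    by (rule measurable_sets[OF assms(1)]) simp
  with assms(3) have "x \<in> f -` {f x} \<inter> space N \<longleftrightarrow> y \<in> f -` {f x} \<inter> space N"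
    unfolding indist_def by (rule bspec)
  then show ?thesis using assms(2,4) by simp
qed

context countable_filtered_prob_space
begin

lemma indist_F_mono: "s \<le> t \<Longrightarrow> indist (F t) x y \<Longrightarrow> indist (F s) x y"
  by (rule indist_mono[OF sets_F_mono])

lemma indist_F_infinity: "indist (F \<infinity>) x y \<longleftrightarrow> indist M x y"
  by (simp only: indist_def sets_F_infinity)

text \<open>The event {\<tau> \<le> \<tau> x} lies in \<open>F (\<tau> x)\<close> and contains
  \<open>x\<close>, hence also \<open>y\<close>. This gives \<tau> y \<le> \<tau> x, after which the
  roles of \<open>x\<close> and \<open>y\<close> can be exchanged.\<close>

lemma stopping_time_indist:
  assumes "stopping_time F \<tau>" "x \<in> space M" "y \<in> space M" "indist (F t) x y" "\<tau> x \<le> t"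
  shows "\<tau> y = \<tau> x"
proof -
  have le: "\<tau> b \<le> t" if "indist (F t) a b" "\<tau> a \<le> t" "a \<in> space M" "b \<in> space M" for a b t
  proof -
    have "{\<omega> \<in> space M. \<tau> \<omega> \<le> t} \<in> sets (F t)"
      using assms(1) by (simp add: stopping_time_def pred_def space_F)
    with that(1) have "a \<in> {\<omega> \<in> space M. \<tau> \<omega> \<le> t} \<longleftrightarrow> b \<in> {\<omega> \<in> space M. \<tau> \<omega> \<le> t}"
      unfolding indist_def by (rule bspec)
    then show ?thesis using that by simp
  qed
  have "\<tau> y \<le> \<tau> x"
    by (rule le[OF indist_F_mono[OF assms(5,4)] order_refl assms(2,3)])
  moreover from this have "\<tau> x \<le> \<tau> y"
    using le[OF indist_F_mono[OF _ indist_sym[OF assms(4)]] order_refl assms(3,2)] assms(5)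
    by (meson order_trans)
  ultimately show ?thesis by simp
qed

lemma stopping_time_if_indist_le:
  assumes "\<And>x y. x \<in> space M \<Longrightarrow> y \<in> space M \<Longrightarrow> indist (F (\<tau> x)) x y \<Longrightarrow> \<tau> y \<le> \<tau> x"
  shows "stopping_time F \<tau>"
proof (rule stopping_timeI)
  fix t
  have "{\<omega> \<in> space M. \<tau> \<omega> \<le> t} \<in> sets (F t)"
  proof (rule sets_if_indist_closed)
    fix x y assume "x \<in> {\<omega> \<in> space M. \<tau> \<omega> \<le> t}" "y \<in> space (F t)" "indist (F t) x y"
    then show "y \<in> {\<omega> \<in> space M. \<tau> \<omega> \<le> t}"
      using assms[of x y] indist_F_mono[of "\<tau> x" t x y] by (auto simp: space_F)
  qed (auto simp: space_F countable_space)
  then show "Measurable.pred (F t) (\<lambda>\<omega>. \<tau> \<omega> \<le> t)"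
    by (simp add: pred_def space_F)
qed

text \<open>The outcomes that are still not separated from \<open>x\<close> at some time after
  \<open>S\<close> form an event of \<open>F s\<close> for every \<open>s > S\<close>, hence of
  \<open>F S\<close> by right continuity. It contains \<open>x\<close> but not
  \<open>y\<close>.\<close>

lemma not_indist_right_limit:
  assumes x: "x \<in> space M" and y: "y \<in> space M" and "S < \<infinity>"
    and sep: "\<And>t. S < t \<Longrightarrow> \<not> indist (F t) x y"
  shows "\<not> indist (F S) x y"
proof
  assume ind: "indist (F S) x y"
  define A where "A = {z \<in> space M. \<exists>t>S. indist (F t) x z}"
  have "A \<in> sets (F s)" if "S < s" for s
  proof (rule sets_if_indist_closed)
    fix z w assume "z \<in> A" and w: "w \<in> space (F s)" "indist (F s) z w"
    then obtain t where t: "S < t" "indist (F t) x z" by (auto simp: A_def)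
    have "indist (F (min s t)) x w"
      using indist_F_mono[OF min.cobounded2 t(2)] indist_F_mono[OF min.cobounded1 w(2)]
      by (rule indist_trans)
    then show "w \<in> A" using t(1) that w(1) by (auto simp: A_def space_F intro!: exI[of _ "min s t"])
  qed (auto simp: A_def space_F countable_space)
  then have "A \<in> sets (F S)" using right_continuous[OF \<open>S < \<infinity>\<close>] by auto
  moreover have "x \<in> A" using x \<open>S < \<infinity>\<close> by (auto simp: A_def)
  ultimately have "y \<in> A" using ind by (auto simp: indist_def)
  then show False using sep by (auto simp: A_def)
qed

text \<open>The infimum over the empty set gives \<infinity> to outcomes that are never
  separated.\<close>

definition separation_time :: "'a \<Rightarrow> 'a \<Rightarrow> ennreal" where
  "separation_time x y = Inf {t. \<not> indist (F t) x y}"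

text \<open>The strict inequality is what right continuity provides: the separation has already
  happened at \<open>separation_time x y\<close>. A grid containing this time therefore leaves no
  separation to the interior of a cell.\<close>

lemma indist_before_separation:
  assumes "x \<in> space M" "y \<in> space M" "indist (F s) x y" "\<not> indist (F t) x y"
  shows "s < separation_time x y" "separation_time x y \<le> t"
proof -
  let ?S = "separation_time x y"
  show "?S \<le> t" unfolding separation_time_def using assms(4) by (auto intro: Inf_lower)
  have "\<not> indist (F t') x y" if "?S < t'" for t'
    using that indist_F_mono unfolding separation_time_def Inf_less_iff by (metis (mono_tags) mem_Collect_eq less_imp_le)
  \<comment> \<open>If the separation time is \<infinity>, then so is \<open>t\<close>, and the
    claim is the assumption on \<open>t\<close>; otherwise right continuity applies.\<close>
  then have "\<not> indist (F ?S) x y"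
    using not_indist_right_limit[OF assms(1,2)] assms(4) \<open>?S \<le> t\<close>
    by (metis infinity_ennreal_def top.not_eq_extremum top_unique)
  then show "s < ?S" using assms(3) indist_F_mono by (meson not_le)
qed

section \<open>Atoms, and finitely many representatives of almost full mass\<close>

definition atom :: "'a \<Rightarrow> 'a set" where
  "atom x = {y \<in> space M. indist M x y}"

lemma sets_atom [measurable]: "atom x \<in> sets M"
proof (rule sets_if_indist_closed[OF countable_space])
  show "z \<in> atom x" if "y \<in> atom x" "z \<in> space M" "indist M y z" for y z
    using that indist_trans[of M x y z] by (simp add: atom_def)
qed (auto simp: atom_def)

lemma finite_representatives:
  assumes "\<eta> > 0"
  shows "\<exists>W. finite W \<and> W \<subseteq> space M \<and> (\<forall>x\<in>W. \<forall>y\<in>W. indist M x y \<longrightarrow> x = y) \<and>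
    prob (space M - (\<Union>w\<in>W. atom w)) < \<eta>"
proof -
  define e where "e = from_nat_into (space M)"
  have range_e: "range e = space M"
    unfolding e_def using countable_space not_empty by (rule range_from_nat_into[rotated])
  \<comment> \<open>The choice depends on \<open>atom x\<close> only, so all points of an atom share
    one representative; this makes distinct elements of \<open>W\<close> distinguishable.\<close>
  define rep where "rep x = (SOME y. y \<in> atom x)" for x
  have self: "x \<in> atom x" if "x \<in> space M" for x using that by (simp add: atom_def)
  have rep: "rep x \<in> atom x" if "x \<in> space M" for x
    unfolding rep_def using self[OF that] by (rule someI)
  have atom_eq: "atom x = atom y" if "indist M x y" for x y
    using that by (auto simp: atom_def intro: indist_trans indist_sym)
  have atom_rep: "atom (rep x) = atom x" if "x \<in> space M" for x
    using rep[OF that] by (intro atom_eq) (auto simp: atom_def intro: indist_sym)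
  define B where "B n = (\<Union>i\<le>n. atom (e i))" for n
  have "(\<lambda>n. measure M (B n)) \<longlonglongrightarrow> measure M (\<Union>n. B n)"
    by (rule finite_Lim_measure_incseq) (force simp: B_def incseq_def)+
  moreover have "(\<Union>n. B n) = space M"
  proof
    show "space M \<subseteq> (\<Union>n. B n)"
    proof
      fix x assume x: "x \<in> space M"
      then obtain n where "x = e n" using range_e by auto
      then show "x \<in> (\<Union>n. B n)" using self[OF x] by (auto simp: B_def)
    qed
  qed (auto simp: B_def atom_def)
  ultimately have "(\<lambda>n. measure M (B n)) \<longlonglongrightarrow> 1" by (simp add: prob_space)
  then have "\<forall>\<^sub>F n in sequentially. 1 - \<eta> < measure M (B n)"
    by (rule order_tendstoD) (use assms in simp)
  then obtain n where n: "1 - \<eta> < measure M (B n)" by (auto simp: eventually_sequentially)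
  define W where "W = (\<lambda>i. rep (e i)) ` {..n}"
  have e_in: "e i \<in> space M" for i using range_e by auto
  show ?thesis
  proof (intro exI conjI ballI impI)
    show "finite W" by (simp add: W_def)
    show "W \<subseteq> space M" using rep e_in by (auto simp: W_def atom_def)
    show "x = y" if "x \<in> W" "y \<in> W" "indist M x y" for x y
    proof -
      from that(1,2) obtain i j where ij: "x = rep (e i)" "y = rep (e j)" unfolding W_def by blast
      have "atom (e i) = atom (e j)" using atom_eq[OF that(3)] atom_rep e_in by (simp add: ij)
      then show ?thesis by (simp add: ij rep_def)
    qed
    have "(\<Union>w\<in>W. atom w) = B n" by (simp add: W_def B_def atom_rep e_in)
    moreover have "prob (space M - B n) = 1 - prob (B n)" by (rule prob_compl) (simp add: B_def)
    ultimately show "prob (space M - (\<Union>w\<in>W. atom w)) < \<eta>" using n by simp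
  qed
qed

lemma integral_approx_finite_sum:
  fixes f :: "'a \<Rightarrow> real"
  assumes W: "finite W" "W \<subseteq> space M" "\<And>x y. x \<in> W \<Longrightarrow> y \<in> W \<Longrightarrow> indist M x y \<Longrightarrow> x = y"
    and inv: "\<And>x y. x \<in> space M \<Longrightarrow> y \<in> space M \<Longrightarrow> indist M x y \<Longrightarrow> f y = f x"
    and bound: "\<And>x. x \<in> space M \<Longrightarrow> \<bar>f x\<bar> \<le> B"
  shows "\<bar>(LINT x|M. f x) - (\<Sum>w\<in>W. prob (atom w) * f w)\<bar> \<le> B * prob (space M - (\<Union>w\<in>W. atom w))"
proof -
  let ?R = "space M - (\<Union>w\<in>W. atom w)"
  have meas [measurable]: "f \<in> borel_measurable M"
    using countable_space inv by (rule measurable_if_indist_invariant)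
  have R [measurable]: "?R \<in> sets M"
    using W(1) by (intro sets.Diff sets.top sets.finite_UN sets_atom)
  have int: "integrable M f"
    using bound by (intro integrable_const_bound[where B = B]) auto
  have disj: "w = v" if "w \<in> W" "v \<in> W" "x \<in> atom w" "x \<in> atom v" for w v x
    by (rule W(3)[OF that(1,2)]) (use that(3,4) in \<open>auto simp: atom_def intro: indist_trans indist_sym\<close>)
  have decomp: "f x = (\<Sum>w\<in>W. f w * indicator (atom w) x) + f x * indicator ?R x" if x: "x \<in> space M" for x
  proof (cases "x \<in> ?R")
    case True
    then show ?thesis by simp
  next
    case False
    then obtain v where v: "v \<in> W" "x \<in> atom v" using x by auto
    have "f w * indicator (atom w) x = (if w = v then f v else 0)" if "w \<in> W" for w
    proof (cases "w = v")
      case False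
      then have "x \<notin> atom w" using disj[OF that v(1) _ v(2)] by blast
      then show ?thesis using False by simp
    qed (use v(2) in simp)
    then have "(\<Sum>w\<in>W. f w * indicator (atom w) x) = f v"
      using W(1) v(1) by simp
    moreover have "f x = f v" using inv[of v x] v W(2) x by (auto simp: atom_def)
    ultimately show ?thesis using False by simp
  qed
  have intR: "integrable M (\<lambda>x. f x * indicator ?R x)"
    using int by (simp add: integrable_real_mult_indicator)
  have intA: "integrable M (indicator (atom w) :: 'a \<Rightarrow> real)" for w
    by (rule integrable_real_indicator) (simp_all add: less_top[symmetric])
  have sumA: "(LINT x|M. (\<Sum>w\<in>W. f w * indicator (atom w) x)) = (\<Sum>w\<in>W. f w * prob (atom w))"
    using intA by (subst Bochner_Integration.integral_sum) (simp_all add: sets_atom[THEN sets.sets_into_space] Int_absorb2)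
  have "(LINT x|M. f x) = (LINT x|M. (\<Sum>w\<in>W. f w * indicator (atom w) x) + f x * indicator ?R x)"
    by (rule Bochner_Integration.integral_cong[OF refl decomp])
  also have "\<dots> = (\<Sum>w\<in>W. f w * prob (atom w)) + (LINT x|M. f x * indicator ?R x)"
    using intR intA by (subst Bochner_Integration.integral_add) (simp_all add: sumA)
  finally have eq: "(LINT x|M. f x) - (\<Sum>w\<in>W. prob (atom w) * f w) = (LINT x|M. f x * indicator ?R x)"
    by (simp add: mult.commute)
  have "\<bar>LINT x|M. f x * indicator ?R x\<bar> \<le> (LINT x|M. \<bar>f x * indicator ?R x\<bar>)"
    by (rule integral_abs_bound)
  also have "\<dots> \<le> (LINT x|M. B * indicator ?R x)"
  proof (rule integral_mono)
    show "integrable M (\<lambda>x. B * indicator ?R x)"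
      by (intro integrable_mult_right integrable_real_indicator R) (simp add: less_top[symmetric])
    show "\<bar>f x * indicator ?R x\<bar> \<le> B * indicator ?R x" if "x \<in> space M" for x
      using bound[OF that] by (simp add: indicator_def)
  qed (use intR in simp)
  also have "\<dots> = B * prob ?R" by simp
  finally show ?thesis using eq by simp
qed

end

section \<open>Time grids\<close>

text \<open>Cells are closed: neighbouring grid points share a cell, and an interior grid point
  belongs to both adjacent cells, so the relation is in general not transitive. A stop at one grid
  point and a reaction at the next thus count as close.\<close>

definition same_cell :: "ennreal set \<Rightarrow> ennreal \<Rightarrow> ennreal \<Rightarrow> bool" where
  "same_cell G s s' \<longleftrightarrow> (\<forall>x\<in>G. \<not> (s < x \<and> x < s') \<and> \<not> (s' < x \<and> x < s))"

lemma same_cell_refl [simp]: "same_cell G s s"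
  by (auto simp: same_cell_def)

lemma same_cell_sym: "same_cell G s s' \<Longrightarrow> same_cell G s' s"
  by (auto simp: same_cell_def)

lemma same_cell_antimono: "G' \<subseteq> G \<Longrightarrow> same_cell G s s' \<Longrightarrow> same_cell G' s s'"
  by (auto simp: same_cell_def)

lemma time_dist_self [simp]: "time_dist s s = 0"
  by (simp add: time_dist_def)

lemma time_dist_le:
  assumes "s \<le> t" "t \<le> s + h"
  shows "time_dist s t \<le> h"
proof (cases "s = t")
  case False
  then have "s < \<infinity>" using assms(1) by (metis infinity_ennreal_def less_top top_unique)
  then show ?thesis using assms False
    by (auto simp: time_dist_def max_absorb2 min_absorb1 ennreal_minus_le_iff add.commute)
qed simp

text \<open>The net consists of multiples of a small step. That \<open>d\<close> lies strictly above
  \<open>s\<close> matters: a later time in the same cell as \<open>s\<close> cannot pass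
  \<open>d\<close>, so it is within \<open>h\<close> of \<open>s\<close>.\<close>

lemma finite_net:
  fixes T h :: ennreal
  assumes "T < \<infinity>" "0 < h"
  obtains D where "finite D" "D \<subseteq> {..<\<infinity>}" "\<And>s. s \<le> T \<Longrightarrow> \<exists>d\<in>D. s < d \<and> d \<le> s + h"
proof -
  obtain T' where T: "T = ennreal T'" "0 \<le> T'" using assms(1) by (cases T) auto
  \<comment> \<open>Here \<open>h\<close> may be \<infinity>, so a finite positive step below it is
    taken.\<close>
  obtain h' where h: "ennreal h' \<le> h" "0 < h'"
    using assms(2) by (cases h) (auto intro: that[of 1])
  define n where "n = nat \<lfloor>T' / h'\<rfloor> + 1"
  define D where "D = (\<lambda>j::nat. ennreal (real j * h')) ` {..n}"
  show thesis
  proof (rule that)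
    show "finite D" by (simp add: D_def)
    show "D \<subseteq> {..<\<infinity>}" by (auto simp: D_def)
    fix s assume "s \<le> T"
    then obtain s' where s: "s = ennreal s'" "0 \<le> s'" "s' \<le> T'"
      using T by (cases s) (auto simp: top_unique)
    define j where "j = nat \<lfloor>s' / h'\<rfloor> + 1"
    have fl: "real (nat \<lfloor>s' / h'\<rfloor>) = \<lfloor>s' / h'\<rfloor>" using s h by simp
    have "s' / h' < real j" "real j \<le> s' / h' + 1"
      unfolding j_def of_nat_add fl by linarith+
    then have "s' < real j * h'" "real j * h' \<le> s' + h'"
      using h(2) by (simp_all add: field_simps)
    moreover have "j \<le> n"
      unfolding j_def n_def using s h by (intro add_mono nat_mono floor_mono divide_right_mono) auto
    moreover from calculation have "s < ennreal (real j * h')" "ennreal (real j * h') \<le> s + ennreal h'"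
      using s h by (simp_all add: ennreal_less_iff flip: ennreal_plus)
    ultimately show "\<exists>d\<in>D. s < d \<and> d \<le> s + h"
      using add_left_mono[OF h(1), of s] unfolding D_def by (blast intro: order_trans)
  qed
qed

section \<open>Behaviour near \<infinity>, uniformly in the other time\<close>

lemma eventually_at_left_infinity:
  "eventually P (at_left (\<infinity>::ennreal)) \<longleftrightarrow> (\<exists>T<\<infinity>. \<forall>b. T < b \<longrightarrow> b < \<infinity> \<longrightarrow> P b)"
  by (rule eventually_at_left[of 0]) simp

lemma at_left_infinity_neq_bot: "at_left (\<infinity>::ennreal) \<noteq> bot"
  unfolding trivial_limit_def eventually_at_left_infinity using dense by blast

lemma limit_at_infinity_close:
  fixes f :: "ennreal \<Rightarrow> real"
  assumes "(f \<longlongrightarrow> l) (at_left \<infinity>)" "T < \<infinity>" "\<And>b. T < b \<Longrightarrow> b < \<infinity> \<Longrightarrow> \<bar>f b - c\<bar> \<le> \<eta>"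
  shows "\<bar>l - c\<bar> \<le> \<eta>"
proof (rule tendsto_upperbound)
  show "((\<lambda>b. \<bar>f b - c\<bar>) \<longlongrightarrow> \<bar>l - c\<bar>) (at_left \<infinity>)"
    by (intro tendsto_intros assms(1))
  show "\<forall>\<^sub>F b in at_left \<infinity>. \<bar>f b - c\<bar> \<le> \<eta>"
    unfolding eventually_at_left_infinity using assms(2,3) by blast
qed (rule at_left_infinity_neq_bot)

lemma limit_at_infinity_D:
  fixes f :: "ennreal \<Rightarrow> real"
  assumes "(f \<longlongrightarrow> f \<infinity>) (at_left \<infinity>)" "\<eta> > 0"
  obtains T where "T < \<infinity>" "\<And>b. T < b \<Longrightarrow> \<bar>f b - f \<infinity>\<bar> \<le> \<eta>"
proof -
  from tendstoD[OF assms] obtain T where T: "T < \<infinity>" "\<And>b. T < b \<Longrightarrow> b < \<infinity> \<Longrightarrow> \<bar>f b - f \<infinity>\<bar> < \<eta>"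
    unfolding eventually_at_left_infinity by (auto simp: dist_real_def)
  have "\<bar>f b - f \<infinity>\<bar> \<le> \<eta>" if "T < b" for b
    using T(2)[OF that] assms(2) by (cases "b = \<infinity>") (auto simp: less_top less_imp_le)
  with T(1) show thesis by (rule that)
qed

text \<open>The joint limit speaks of finite times only. When one time is \<infinity>, the bound is
  inherited by the limit in that argument, which is why it is not strict.\<close>

lemma joint_limit_at_infinity:
  fixes f :: "ennreal \<Rightarrow> ennreal \<Rightarrow> real"
  assumes fst: "\<And>t. t < \<infinity> \<Longrightarrow> ((\<lambda>a. f a t) \<longlongrightarrow> f \<infinity> t) (at_left \<infinity>)"
    and snd: "\<And>s. s < \<infinity> \<Longrightarrow> ((\<lambda>b. f s b) \<longlongrightarrow> f s \<infinity>) (at_left \<infinity>)"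
    and joint: "((\<lambda>(a, b). f a b) \<longlongrightarrow> f \<infinity> \<infinity>) (at_left \<infinity> \<times>\<^sub>F at_left \<infinity>)"
    and "\<eta> > 0"
  obtains T where "T < \<infinity>" "\<And>a b. T < a \<Longrightarrow> T < b \<Longrightarrow> \<bar>f a b - f \<infinity> \<infinity>\<bar> \<le> \<eta>"
proof -
  from tendstoD[OF joint \<open>\<eta> > 0\<close>] obtain P Q where
    "eventually P (at_left \<infinity>)" "eventually Q (at_left \<infinity>)"
    and PQ: "\<And>a b. P a \<Longrightarrow> Q b \<Longrightarrow> \<bar>f a b - f \<infinity> \<infinity>\<bar> < \<eta>"
    unfolding eventually_prod_filter by (auto simp: dist_real_def)
  then obtain T1 T2 where T12: "T1 < \<infinity>" "T2 < \<infinity>" "\<And>a. T1 < a \<Longrightarrow> a < \<infinity> \<Longrightarrow> P a" "\<And>b. T2 < b \<Longrightarrow> b < \<infinity> \<Longrightarrow> Q b"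
    unfolding eventually_at_left_infinity by blast
  define T where "T = max T1 T2"
  have T: "T < \<infinity>" using T12(1,2) by (simp add: T_def)
  have fin: "\<bar>f a b - f \<infinity> \<infinity>\<bar> \<le> \<eta>" if "T < a" "T < b" "a < \<infinity>" "b < \<infinity>" for a b
    using PQ[OF T12(3,4)] that by (simp add: T_def less_imp_le)
  have "\<bar>f a b - f \<infinity> \<infinity>\<bar> \<le> \<eta>" if "T < a" "T < b" for a b
  proof (cases "a < \<infinity>")
    case a: True
    show ?thesis
    proof (cases "b < \<infinity>")
      case False
      then have "b = \<infinity>" by (simp add: less_top[symmetric])
      then show ?thesis using limit_at_infinity_close[OF snd[OF a] T fin] that(1) a by blast
    qed (use fin that a in blast)
  next
    case False
    then have a: "a = \<infinity>" by (simp add: less_top[symmetric])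
    show ?thesis
    proof (cases "b < \<infinity>")
      case True
      then show ?thesis using limit_at_infinity_close[OF fst[OF True] T fin] that(2) a by blast
    next
      case False
      then have "b = \<infinity>" by (simp add: less_top[symmetric])
      then show ?thesis using a \<open>\<eta> > 0\<close> by simp
    qed
  qed
  with T show thesis by (rule that)
qed

lemma uniform_cells_one_argument:
  fixes f :: "ennreal \<Rightarrow> ennreal \<Rightarrow> real"
  assumes lim: "\<And>s. s < \<infinity> \<Longrightarrow> ((\<lambda>b. f s b) \<longlongrightarrow> f s \<infinity>) (at_left \<infinity>)"
    and T: "T < \<infinity>" "\<And>a b. T < a \<Longrightarrow> T < b \<Longrightarrow> \<bar>f a b - c\<bar> \<le> \<eta>"
    and h: "0 < h"
    and mod1: "\<And>s s' t. time_dist s s' \<le> h \<Longrightarrow> \<bar>f s t - f s' t\<bar> \<le> \<eta>"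
    and mod2: "\<And>s t t'. time_dist t t' \<le> h \<Longrightarrow> \<bar>f s t - f s t'\<bar> \<le> \<eta>"
    and \<eta>: "0 < \<eta>"
  shows "\<exists>G. finite G \<and> (\<forall>s t t'. same_cell G t t' \<longrightarrow> \<bar>f s t - f s t'\<bar> \<le> 4 * \<eta>)"
proof -
  obtain D where D: "finite D" "D \<subseteq> {..<\<infinity>}" "\<And>s. s \<le> T \<Longrightarrow> \<exists>d\<in>D. s < d \<and> d \<le> s + h"
    using finite_net[OF T(1) h] by metis
  have "\<exists>T'<\<infinity>. \<forall>b>T'. \<bar>f d b - f d \<infinity>\<bar> \<le> \<eta>" if "d \<in> D" for d
    using limit_at_infinity_D[OF lim \<eta>] D(2) that by (metis lessThan_iff subsetD)
  then obtain T' where T': "\<And>d. d \<in> D \<Longrightarrow> T' d < \<infinity>" "\<And>d b. d \<in> D \<Longrightarrow> T' d < b \<Longrightarrow> \<bar>f d b - f d \<infinity>\<bar> \<le> \<eta>"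
    by metis
  define T2 where "T2 = Max (insert T (T' ` D))"
  have T2: "T2 < \<infinity>" "T \<le> T2" "\<And>d. d \<in> D \<Longrightarrow> T' d \<le> T2"
    unfolding T2_def using T(1) T'(1) D(1) by (auto simp: Max_less_iff)
  \<comment> \<open>The bound has to hold for all \<open>s\<close> at once. For
    \<open>s \<le> T\<close> there are four errors \<eta>: from \<open>s\<close> to the net point
    \<open>d\<close> at \<open>b\<close> and at \<open>b'\<close>, and from \<open>b\<close> and
    \<open>b'\<close> to \<infinity> along \<open>f d\<close>. For larger \<open>s\<close> both
    values are close to \<open>c\<close>.\<close>
  have tail: "\<bar>f s b - f s b'\<bar> \<le> 4 * \<eta>" if b: "T2 < b" "T2 < b'" for s b b'
  proof (cases "s \<le> T")
    case True
    then obtain d where d: "d \<in> D" "s < d" "d \<le> s + h" using D(3) by blast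
    then have "time_dist s d \<le> h" by (intro time_dist_le) auto
    then have "\<bar>f s b - f d b\<bar> \<le> \<eta>" "\<bar>f s b' - f d b'\<bar> \<le> \<eta>" by (rule mod1)+
    moreover have "\<bar>f d b - f d \<infinity>\<bar> \<le> \<eta>" "\<bar>f d b' - f d \<infinity>\<bar> \<le> \<eta>"
      using T2(3)[OF d(1)] b by (blast intro: T'(2)[OF d(1)] le_less_trans)+
    ultimately show ?thesis by linarith
  next
    case False
    then have "\<bar>f s b - c\<bar> \<le> \<eta>" "\<bar>f s b' - c\<bar> \<le> \<eta>"
      using T2(2) b by (auto simp: not_le intro: T(2) le_less_trans)
    then show ?thesis using \<eta> by linarith
  qed
  obtain G where G: "finite G" "\<And>t. t \<le> T2 \<Longrightarrow> \<exists>d\<in>G. t < d \<and> d \<le> t + h"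
    using finite_net[OF T2(1) h] by metis
  have le: "\<bar>f s t - f s t'\<bar> \<le> 4 * \<eta>" if "same_cell G t t'" "t \<le> t'" for s t t'
  proof (cases "t \<le> T2")
    case True
    then obtain d where d: "d \<in> G" "t < d" "d \<le> t + h" using G(2) by blast
    then have "t' \<le> d" using that by (force simp: same_cell_def)
    then have "time_dist t t' \<le> h" using d that(2) by (intro time_dist_le) auto
    then have "\<bar>f s t - f s t'\<bar> \<le> \<eta>" by (rule mod2)
    then show ?thesis using \<eta> by linarith
  qed (use tail that(2) in force)
  have "\<bar>f s t - f s t'\<bar> \<le> 4 * \<eta>" if "same_cell G t t'" for s t t'
    using le[of t t' s] le[of t' t s] that same_cell_sym[OF that] by (cases "t \<le> t'") (auto simp: abs_minus_commute)
  with G(1) show ?thesis by blast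
qed

text \<open>The modulus \<open>r\<close> only controls finite distances, so the cell reaching up to \<open>\<infinity>\<close> is handled
  by the limits of \<open>f\<close>, made uniform in the other argument by a finite net.\<close>

lemma uniform_cells:
  fixes f :: "ennreal \<Rightarrow> ennreal \<Rightarrow> real" and r :: "ennreal \<Rightarrow> real"
  assumes fst: "\<And>t. t < \<infinity> \<Longrightarrow> ((\<lambda>a. f a t) \<longlongrightarrow> f \<infinity> t) (at_left \<infinity>)"
    and snd: "\<And>s. s < \<infinity> \<Longrightarrow> ((\<lambda>b. f s b) \<longlongrightarrow> f s \<infinity>) (at_left \<infinity>)"
    and joint: "((\<lambda>(a, b). f a b) \<longlongrightarrow> f \<infinity> \<infinity>) (at_left \<infinity> \<times>\<^sub>F at_left \<infinity>)"
    and modulus: "\<And>s t s' t'. \<bar>f s t - f s' t'\<bar> \<le> r (time_dist s s' + time_dist t t')"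
    and r_mono: "mono r" and r_lim: "(r \<longlongrightarrow> 0) (at_right 0)"
    and "\<epsilon> > 0"
  shows "\<exists>G. finite G \<and> (\<forall>s s' t t'. same_cell G s s' \<longrightarrow> same_cell G t t' \<longrightarrow>
    \<bar>f s t - f s' t'\<bar> \<le> \<epsilon>)"
proof -
  \<comment> \<open>The two arguments are changed one after the other, each at a cost of 4 *
    \<eta>.\<close>
  define \<eta> where "\<eta> = \<epsilon> / 8"
  have \<eta>: "\<eta> > 0" using \<open>\<epsilon> > 0\<close> by (simp add: \<eta>_def)
  have "\<forall>\<^sub>F x in at_right (0::ennreal). r x < \<eta>"
    by (rule order_tendstoD(2)[OF r_lim \<eta>])
  then obtain b :: ennreal where "0 < b" and b: "\<And>x. 0 < x \<Longrightarrow> x < b \<Longrightarrow> r x < \<eta>"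
    by (subst (asm) eventually_at_right[of 0 \<infinity>]) auto
  then obtain h where h: "0 < h" "r h < \<eta>" using dense by blast
  have mod: "r x \<le> \<eta>" if "x \<le> h" for x
    using monoD[OF r_mono that] h(2) by simp
  have mod1: "\<bar>f s t - f s' t\<bar> \<le> \<eta>" if "time_dist s s' \<le> h" for s s' t
    using modulus[of s t s' t] mod[OF that] by simp
  have mod2: "\<bar>f s t - f s t'\<bar> \<le> \<eta>" if "time_dist t t' \<le> h" for s t t'
    using modulus[of s t s t'] mod[OF that] by simp
  obtain T where T: "T < \<infinity>" "\<And>a b. T < a \<Longrightarrow> T < b \<Longrightarrow> \<bar>f a b - f \<infinity> \<infinity>\<bar> \<le> \<eta>"
    using joint_limit_at_infinity[OF fst snd joint \<eta>] by blast
  have "\<exists>G. finite G \<and> (\<forall>s t t'. same_cell G t t' \<longrightarrow> \<bar>f s t - f s t'\<bar> \<le> 4 * \<eta>)"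
    by (rule uniform_cells_one_argument[where T = T and h = h and c = "f \<infinity> \<infinity>"])
      (fact snd T h(1) mod1 mod2 \<eta>)+
  then obtain G1 where G1: "finite G1" "\<And>s t t'. same_cell G1 t t' \<Longrightarrow> \<bar>f s t - f s t'\<bar> \<le> 4 * \<eta>"
    by blast
  have T_swap: "\<bar>f b a - f \<infinity> \<infinity>\<bar> \<le> \<eta>" if "T < a" "T < b" for a b
    using T(2)[OF that(2,1)] .
  have "\<exists>G. finite G \<and> (\<forall>s t t'. same_cell G t t' \<longrightarrow> \<bar>f t s - f t' s\<bar> \<le> 4 * \<eta>)"
    by (rule uniform_cells_one_argument[where f = "\<lambda>b a. f a b" and T = T and h = h and c = "f \<infinity> \<infinity>"])
      (fact fst T(1) T_swap h(1) mod1 mod2 \<eta>)+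
  then obtain G2 where G2: "finite G2" "\<And>s t t'. same_cell G2 t t' \<Longrightarrow> \<bar>f t s - f t' s\<bar> \<le> 4 * \<eta>"
    by blast
  show ?thesis
  proof (intro exI[of _ "G1 \<union> G2"] conjI allI impI)
    fix s s' t t' assume cells: "same_cell (G1 \<union> G2) s s'" "same_cell (G1 \<union> G2) t t'"
    from G1(2)[OF same_cell_antimono[OF Un_upper1 cells(2)], of s] G2(2)[OF same_cell_antimono[OF Un_upper2 cells(1)], of t']
    show "\<bar>f s t - f s' t'\<bar> \<le> \<epsilon>" unfolding \<eta>_def by linarith
  qed (use G1 G2 in simp)
qed

section \<open>Rounding down to a finite grid\<close>

locale time_grid =
  fixes g :: "nat \<Rightarrow> ennreal" and N :: nat
  assumes g_0: "g 0 = 0"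
    and g_infinity: "N \<le> k \<Longrightarrow> g k = \<infinity>"
    and g_strict: "i < j \<Longrightarrow> j \<le> N \<Longrightarrow> g i < g j"
begin

lemma g_mono: "i \<le> j \<Longrightarrow> g i \<le> g j"
  using g_strict[of i j] g_infinity[of j] by (cases "i = j"; cases "j \<le> N") auto

lemma g_less_iff: "i \<le> N \<Longrightarrow> j \<le> N \<Longrightarrow> g i < g j \<longleftrightarrow> i < j"
  by (meson g_mono g_strict not_le)

definition idx :: "ennreal \<Rightarrow> nat" where
  "idx t = Max {k. k \<le> N \<and> g k \<le> t}"

lemma idx_props: "idx t \<le> N" "g (idx t) \<le> t" "k \<le> N \<Longrightarrow> g k \<le> t \<Longrightarrow> k \<le> idx t"
proof -
  have fin: "finite {k. k \<le> N \<and> g k \<le> t}" by simp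
  have "0 \<in> {k. k \<le> N \<and> g k \<le> t}" by (simp add: g_0)
  then have "idx t \<in> {k. k \<le> N \<and> g k \<le> t}"
    unfolding idx_def using fin by (intro Max_in) auto
  then show "idx t \<le> N" "g (idx t) \<le> t" by auto
  show "k \<le> N \<Longrightarrow> g k \<le> t \<Longrightarrow> k \<le> idx t"
    unfolding idx_def using fin by (intro Max_ge) auto
qed

lemma le_idx_iff: "k \<le> N \<Longrightarrow> k \<le> idx t \<longleftrightarrow> g k \<le> t"
  using idx_props(2)[of t] idx_props(3)[of k t] g_mono[of k "idx t"] by (meson order_trans)

lemma idx_g: "k \<le> N \<Longrightarrow> idx (g k) = k"
  by (meson g_less_iff idx_props(1,2) le_antisym le_idx_iff not_le order_refl)

lemma idx_less_Suc: "idx t < N \<Longrightarrow> t < g (Suc (idx t))"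
  using le_idx_iff[of "Suc (idx t)" t] by simp

lemma idx_lt_N_iff: "idx t < N \<longleftrightarrow> t < \<infinity>"
  using le_idx_iff[of N t] g_infinity[of N] by (auto simp: not_le[symmetric])

lemma same_cell_idx: "same_cell (g ` {..N}) s (g (idx s))"
proof -
  have "\<not> (s < g k \<and> g k < g (idx s)) \<and> \<not> (g (idx s) < g k \<and> g k < s)" if "k \<le> N" for k
    using idx_props(2)[of s] le_idx_iff[OF that, of s] g_less_iff[OF idx_props(1) that, of s] by auto
  then show ?thesis by (simp add: same_cell_def)
qed

lemma same_cell_Suc: "same_cell (g ` {..N}) (g b) (g (Suc b))"
proof (cases "b < N")
  case True
  then show ?thesis
    by (auto simp: same_cell_def g_less_iff Suc_le_eq)
qed (simp add: g_infinity)

text \<open>A time after \<open>g b\<close> may round down to \<open>g b\<close> itself, which is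
  too early for a reaction. It is then moved up to \<open>g (Suc b)\<close>, the other end of the
  same closed cell.\<close>

lemma same_cell_max_Suc_idx:
  assumes "g b < s" "b < N"
  shows "same_cell (g ` {..N}) s (g (max (Suc b) (idx s)))"
proof (cases "Suc b \<le> idx s")
  case True
  then show ?thesis using same_cell_idx by (simp add: max_absorb2)
next
  case False
  then have "s < g (Suc b)" using le_idx_iff[of "Suc b" s] assms(2) by auto
  then have "\<not> (s < g k \<and> g k < g (Suc b)) \<and> \<not> (g (Suc b) < g k \<and> g k < s)" if "k \<le> N" for k
    using assms that g_less_iff[of k "Suc b"] g_less_iff[of b k] by force
  then show ?thesis using False by (simp add: same_cell_def max_absorb1)
qed

lemma measurable_idx [measurable]: "idx \<in> measurable borel (count_space UNIV)"
proof (rule measurableI)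
  fix A :: "nat set"
  have "idx -` {k} = (if k \<le> N then {g k..} - (if k < N then {g (Suc k)..} else {}) else {})" for k
  proof -
    have "idx t = k \<longleftrightarrow> (if k \<le> N then g k \<le> t \<and> \<not> (k < N \<and> g (Suc k) \<le> t) else False)" for t
      using le_idx_iff[of k t] le_idx_iff[of "Suc k" t] idx_props(1)[of t] by (cases "k < N") auto
    then show ?thesis by (intro set_eqI) (simp split: if_split)
  qed
  then have "idx -` {k} \<in> sets borel" for k by simp
  then have "(\<Union>k\<in>A. idx -` {k}) \<in> sets borel" by (intro sets.countable_UN'') auto
  then show "idx -` A \<inter> space borel \<in> sets borel"
    by (simp add: vimage_UN[symmetric] UN_singleton)
qed simp

end

lemma time_grid_exists:
  assumes "finite G" "0 \<in> G" "\<infinity> \<in> G"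
  obtains g N where "time_grid g N" "g ` {..N} = G"
proof -
  define xs where "xs = sorted_list_of_set G"
  define N where "N = card G - 1"
  define g where "g k = (if k \<le> N then xs ! k else \<infinity>)" for k
  have "G \<noteq> {}" using assms by auto
  then have card: "card G > 0" using assms(1) by (simp add: card_gt_0_iff)
  have len: "length xs = Suc N" using card by (simp add: xs_def N_def)
  have set: "set xs = G" using assms(1) by (simp add: xs_def)
  have strict: "sorted_wrt (<) xs" by (simp add: xs_def strict_sorted_list_of_set)
  have img: "g ` {..N} = G"
  proof -
    have "g ` {..N} = (!) xs ` {..<length xs}"
      unfolding len lessThan_Suc_atMost by (intro image_cong) (auto simp: g_def)
    then show ?thesis unfolding set[symmetric] by (auto simp: set_conv_nth)
  qed
  have lt: "g i < g j" if "i < j" "j \<le> N" for i j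
    using sorted_wrt_nth_less[OF strict, of i j] that len by (simp add: g_def)
  have "time_grid g N"
  proof
    obtain i where i: "i \<le> N" "g i = 0" using assms(2) img by force
    then show "g 0 = 0" using lt[of 0 i] by (cases "i = 0") auto
    obtain j where j: "j \<le> N" "g j = \<infinity>" using assms(3) img by force
    have "g N = \<infinity>" using j lt[of j N] by (cases "j = N") auto
    then show "g k = \<infinity>" if "N \<le> k" for k using that by (cases "k = N") (auto simp: g_def)
  qed (rule lt)
  then show thesis using img by (rule that)
qed

section \<open>The discretized game\<close>

text \<open>The bound in \<open>reward_process\<close> covers finite times; the bounded modulus
  carries it from \<open>U 0 0\<close> to all times.\<close>

lemma reward_process_bounded:
  fixes r :: "ennreal \<Rightarrow> real"
  assumes reward: "reward_process M F U" and r_bounded: "bounded (range r)"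
    and modulus: "\<And>s t s' t' \<omega>. \<omega> \<in> space M \<Longrightarrow> \<bar>U s t \<omega> - U s' t' \<omega>\<bar> \<le> r (time_dist s s' + time_dist t t')"
  obtains B where "\<And>s t \<omega>. \<omega> \<in> space M \<Longrightarrow> \<bar>U s t \<omega>\<bar> \<le> B"
proof -
  from reward obtain B where B: "\<forall>s<\<infinity>. \<forall>t<\<infinity>. \<forall>\<omega>\<in>space M. \<bar>U s t \<omega>\<bar> \<le> B"
    unfolding reward_process_def by blast
  from r_bounded obtain R where R: "\<And>x. \<bar>r x\<bar> \<le> R"
    by (auto simp: bounded_iff)
  show thesis
  proof (rule that)
    fix s t \<omega> assume \<omega>: "\<omega> \<in> space M"
    have "\<bar>U 0 0 \<omega>\<bar> \<le> B" using B \<omega> by simp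
    then show "\<bar>U s t \<omega>\<bar> \<le> B + R"
      using modulus[OF \<omega>, of s t 0 0] R[of "time_dist s 0 + time_dist t 0"] by linarith
  qed
qed

section \<open>Payoffs are constant on atoms\<close>

context countable_filtered_prob_space
begin

text \<open>For finite times this is measurability at \<open>max s t\<close>. The limits run through
  finite times, so uniqueness of limits extends it to \<infinity>.\<close>

lemma reward_process_indist:
  assumes reward: "reward_process M F U"
    and x: "x \<in> space M" and y: "y \<in> space M" and xy: "indist M x y"
  shows "U s t y = U s t x"
proof -
  have ind: "indist (F t) x y" for t
    using xy by (metis indist_F_infinity indist_F_mono infinity_ennreal_def top_greatest)
  have fin: "U s t y = U s t x" if "s < \<infinity>" "t < \<infinity>" for s t
  proof (rule indist_measurable_eq[of _ "F (max s t)"])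
    show "U s t \<in> borel_measurable (F (max s t))"
      using reward that by (simp add: reward_process_def)
  qed (use x y ind in \<open>simp_all add: space_F\<close>)
  have lims: "((\<lambda>b. U s b \<omega>) \<longlongrightarrow> U s \<infinity> \<omega>) (at_left \<infinity>)" "((\<lambda>a. U a s \<omega>) \<longlongrightarrow> U \<infinity> s \<omega>) (at_left \<infinity>)"
    if "s < \<infinity>" "\<omega> \<in> space M" for s \<omega>
    using reward that unfolding reward_process_def by blast+
  have joint: "((\<lambda>(a, b). U a b \<omega>) \<longlongrightarrow> U \<infinity> \<infinity> \<omega>) (at_left \<infinity> \<times>\<^sub>F at_left \<infinity>)" if "\<omega> \<in> space M" for \<omega>
    using reward that unfolding reward_process_def by blast
  have ev: "\<forall>\<^sub>F b in at_left (\<infinity>::ennreal). b < \<infinity>"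
    unfolding eventually_at_left_infinity by (intro exI[of _ 0]) simp
  have snd: "U s \<infinity> y = U s \<infinity> x" if s: "s < \<infinity>" for s
    using at_left_infinity_neq_bot lims(1)[OF s y]
  proof (rule tendsto_unique)
    show "((\<lambda>b. U s b y) \<longlongrightarrow> U s \<infinity> x) (at_left \<infinity>)"
      using lims(1)[OF s x] by (rule Lim_transform_eventually) (use ev in eventually_elim, simp add: fin[OF s])
  qed
  have fst: "U \<infinity> t y = U \<infinity> t x" if t: "t < \<infinity>" for t
    using at_left_infinity_neq_bot lims(2)[OF t y]
  proof (rule tendsto_unique)
    show "((\<lambda>a. U a t y) \<longlongrightarrow> U \<infinity> t x) (at_left \<infinity>)"
      using lims(2)[OF t x] by (rule Lim_transform_eventually) (use ev in eventually_elim, simp add: fin[OF _ t])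
  qed
  have "U \<infinity> \<infinity> y = U \<infinity> \<infinity> x"
    using _ joint[OF y]
  proof (rule tendsto_unique)
    show "at_left (\<infinity>::ennreal) \<times>\<^sub>F at_left (\<infinity>::ennreal) \<noteq> bot"
      by (simp add: prod_filter_eq_bot at_left_infinity_neq_bot del: infinity_ennreal_def)
    have "\<forall>\<^sub>F p in at_left \<infinity> \<times>\<^sub>F at_left \<infinity>. (\<lambda>(a, b). U a b x) p = (\<lambda>(a, b). U a b y) p"
      unfolding eventually_prod_filter
      by (intro exI[of _ "\<lambda>b. b < \<infinity>"] conjI ev) (simp add: fin)
    with joint[OF x] show "((\<lambda>(a, b). U a b y) \<longlongrightarrow> U \<infinity> \<infinity> x) (at_left \<infinity> \<times>\<^sub>F at_left \<infinity>)"
      by (rule Lim_transform_eventually)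
  qed
  then show ?thesis using fin snd fst
    by (cases "s < \<infinity>"; cases "t < \<infinity>") (simp_all add: less_top[symmetric])
qed

lemma stopping_time_indist_M:
  assumes "stopping_time F \<tau>" "x \<in> space M" "y \<in> space M" "indist M x y"
  shows "\<tau> y = \<tau> x"
  using stopping_time_indist[OF assms(1-3), of \<infinity>] assms(4) by (metis indist_F_infinity infinity_ennreal_def top_greatest)

lemma strategiesD:
  assumes "\<rho> \<in> stopping_strategies M F"
  shows "stopping_time F (fst \<rho>)" "t < \<infinity> \<Longrightarrow> stopping_time F (snd \<rho> t)"
    "t < \<infinity> \<Longrightarrow> \<omega> \<in> space M \<Longrightarrow> t < snd \<rho> t \<omega>"
  using assms
  by (simp_all add: stopping_strategies_def stopping_times_def reaction_maps_def stopping_times_after_def mem_Times_iff)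

lemma realized_first: "fst \<rho> \<omega> \<le> fst \<tau> \<omega> \<Longrightarrow> realized \<rho> \<tau> \<omega> = fst \<rho> \<omega>"
  by (simp add: realized_def)

lemma realized_second: "fst \<tau> \<omega> < fst \<rho> \<omega> \<Longrightarrow> realized \<rho> \<tau> \<omega> = snd \<rho> (fst \<tau> \<omega>) \<omega>"
  by (simp add: realized_def)

text \<open>On an atom the opponent's first time is constant, and it is finite when it is the
  smaller one. The reaction is thus evaluated at one fixed time, where it is a stopping
  time.\<close>

lemma realized_indist:
  assumes \<rho>: "\<rho> \<in> stopping_strategies M F" and \<tau>: "\<tau> \<in> stopping_strategies M F"
    and x: "x \<in> space M" and y: "y \<in> space M" and xy: "indist M x y"
  shows "realized \<rho> \<tau> y = realized \<rho> \<tau> x"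
proof -
  note eq = stopping_time_indist_M[OF _ x y xy]
  have eqs: "fst \<rho> y = fst \<rho> x" "fst \<tau> y = fst \<tau> x"
    using eq strategiesD(1)[OF \<rho>] strategiesD(1)[OF \<tau>] by blast+
  show ?thesis
  proof (cases "fst \<rho> x \<le> fst \<tau> x")
    case True
    then show ?thesis by (simp add: realized_first eqs)
  next
    case False
    then have lt: "fst \<tau> x < fst \<rho> x" by simp
    then have "fst \<tau> x < \<infinity>" by (simp add: less_top[symmetric]) (metis less_top not_less_iff_gr_or_eq top.not_eq_extremum)
    then show ?thesis using eq[OF strategiesD(2)[OF \<rho>]] lt by (simp add: realized_second eqs)
  qed
qed

end

section \<open>Restriction to the representatives and lifting back\<close>

locale discretized_game = countable_filtered_prob_space M F + time_grid g N
  for M :: "'a measure" and F :: "ennreal \<Rightarrow> 'a measure" and g :: "nat \<Rightarrow> ennreal" and N :: nat +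
  fixes W :: "'a set"
  assumes finite_W: "finite W" and W_space: "W \<subseteq> space M"
    and W_reps: "\<And>x y. x \<in> W \<Longrightarrow> y \<in> W \<Longrightarrow> indist M x y \<Longrightarrow> x = y"
    and separation: "\<And>x y. x \<in> W \<Longrightarrow> y \<in> W \<Longrightarrow> separation_time x y \<in> g ` {..N}"
begin

definition cl :: "nat \<Rightarrow> 'a \<Rightarrow> 'a set" where
  "cl k x = {y \<in> W. indist (F (g k)) x y}"

sublocale finite_filtration W cl N
proof
  show "cl j x \<subseteq> cl i x" if "i \<le> j" for i j x
    using indist_F_mono[OF g_mono[OF that]] by (auto simp: cl_def)
  show "cl k y = cl k x" if "y \<in> cl k x" for x y k
    using that by (auto simp: cl_def intro: indist_trans indist_sym)
qed (auto simp: cl_def finite_W)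

text \<open>Rounding down to the grid keeps stopping times adapted on \<open>W\<close>, since no two outcomes of \<open>W\<close>
  separate strictly inside a cell.\<close>

lemma indist_in_cell:
  assumes x: "x \<in> W" and y: "y \<in> cl (idx t) x"
  shows "indist (F t) x y"
proof (rule ccontr)
  assume not: "\<not> indist (F t) x y"
  have y': "y \<in> W" "indist (F (g (idx t))) x y" using y by (auto simp: cl_def)
  have "x \<in> space M" "y \<in> space M" using x y' W_space by auto
  note sep = indist_before_separation[OF this y'(2) not]
  obtain k where k: "k \<le> N" "separation_time x y = g k" using separation[OF x y'(1)] by auto
  have "k \<le> idx t" using sep(2) k by (simp add: le_idx_iff)
  then show False using sep(1) k(2) g_mono[of k "idx t"] by simp
qed

lemma adapted_idx:
  assumes "stopping_time F \<sigma>"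
  shows "adapted 0 (\<lambda>x. idx (\<sigma> x))"
  unfolding adapted_def
proof (intro ballI conjI)
  fix x y assume x: "x \<in> W" and y: "y \<in> cl (idx (\<sigma> x)) x"
  have "x \<in> space M" "y \<in> space M" using x y W_space by (auto simp: cl_def)
  then show "idx (\<sigma> y) = idx (\<sigma> x)"
    using stopping_time_indist[OF assms _ _ indist_in_cell[OF x y] order_refl] by simp
qed (simp_all add: idx_props)

text \<open>Where no outcome of \<open>W\<close> qualifies, the infimum is over the empty set: the lifted time is \<open>\<infinity>\<close>.\<close>

definition lift :: "('a \<Rightarrow> nat) \<Rightarrow> 'a \<Rightarrow> ennreal" where
  "lift \<kappa> \<omega> = (INF x\<in>{x \<in> W. indist (F (g (\<kappa> x))) x \<omega>}. g (\<kappa> x))"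

text \<open>By adaptedness every element of \<open>W\<close> that qualifies for \<open>w\<close> has
  the same \<kappa> as \<open>w\<close>, so the infimum is over a single value.\<close>

lemma lift_on_W:
  assumes \<kappa>: "adapted m \<kappa>" and w: "w \<in> W"
  shows "lift \<kappa> w = g (\<kappa> w)"
proof -
  have "g (\<kappa> x) = g (\<kappa> w)" if "x \<in> {x \<in> W. indist (F (g (\<kappa> x))) x w}" for x
    using adapted_eq[OF \<kappa>, of x "\<kappa> x" w] that w by (simp add: cl_def)
  then have "lift \<kappa> w = (INF x\<in>{x \<in> W. indist (F (g (\<kappa> x))) x w}. g (\<kappa> w))"
    unfolding lift_def by (intro INF_cong) auto
  also have "\<dots> = g (\<kappa> w)" using w by (intro cINF_const) auto
  finally show ?thesis .
qed

lemma lift_ge: "adapted m \<kappa> \<Longrightarrow> g m \<le> lift \<kappa> \<omega>"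
  unfolding lift_def by (intro INF_greatest g_mono) (auto simp: adapted_def)

text \<open>The infimum is over a finite set, so if that set is nonempty it is attained at some
  \<open>w\<close>. An outcome that cannot be told from \<open>x\<close> at that time cannot be told
  from \<open>w\<close> either; hence \<open>w\<close> qualifies for it too and bounds its lifted
  time.\<close>

lemma stopping_time_lift: "stopping_time F (lift \<kappa>)"
proof (rule stopping_time_if_indist_le)
  fix x y assume xy: "indist (F (lift \<kappa> x)) x y"
  let ?A = "\<lambda>\<omega>. {w \<in> W. indist (F (g (\<kappa> w))) w \<omega>}"
  show "lift \<kappa> y \<le> lift \<kappa> x"
  proof (cases "?A x = {}")
    case True
    then show ?thesis by (simp add: lift_def del: Collect_empty_eq)
  next
    case False
    have "finite ((\<lambda>w. g (\<kappa> w)) ` ?A x)" using finite_W by simp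
    then have "lift \<kappa> x \<in> (\<lambda>w. g (\<kappa> w)) ` ?A x"
      unfolding lift_def using False by (subst cInf_eq_Min) (auto intro: Min_in simp del: Collect_empty_eq)
    then obtain w where w: "w \<in> W" "indist (F (g (\<kappa> w))) w x" "lift \<kappa> x = g (\<kappa> w)" by auto
    then have "indist (F (g (\<kappa> w))) w y" using xy indist_trans by metis
    then have "lift \<kappa> y \<le> g (\<kappa> w)"
      unfolding lift_def using w(1) by (intro INF_lower) simp
    then show ?thesis by (simp add: w(3))
  qed
qed

definition reaction :: "(nat \<Rightarrow> 'a \<Rightarrow> nat) \<Rightarrow> ennreal \<Rightarrow> 'a \<Rightarrow> ennreal" where
  "reaction \<phi> t = lift (\<phi> (idx t))"

lemma strategy_in_strategies:
  assumes "\<And>k. k < N \<Longrightarrow> adapted (Suc k) (\<phi> k)"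
  shows "(lift \<kappa>, reaction \<phi>) \<in> stopping_strategies M F"
proof -
  have lift_meas: "lift \<kappa> \<in> borel_measurable M" for \<kappa>
    using countable_space stopping_time_indist_M[OF stopping_time_lift]
    by (rule measurable_if_indist_invariant)
  have "(\<lambda>p. reaction \<phi> (fst p) (snd p)) \<in> borel_measurable (borel \<Otimes>\<^sub>M M)"
    unfolding reaction_def
  proof (rule measurable_compose_countable[where g = "\<lambda>p. idx (fst p)" and f = "\<lambda>i p. lift (\<phi> i) (snd p)"])
    show "(\<lambda>p. lift (\<phi> i) (snd p)) \<in> borel_measurable (borel \<Otimes>\<^sub>M M)" for i
      using lift_meas by measurable
  qed measurable
  moreover have "t < reaction \<phi> t \<omega>" if "t < \<infinity>" for t \<omega>
  proof -
    have k: "idx t < N" using that by (simp add: idx_lt_N_iff)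
    show ?thesis
      unfolding reaction_def using idx_less_Suc[OF k] lift_ge[OF assms[OF k]] by (rule less_le_trans)
  qed
  ultimately have "reaction \<phi> \<in> reaction_maps M F"
    by (simp add: reaction_maps_def stopping_times_after_def stopping_times_def case_prod_beta)
      (simp add: reaction_def stopping_time_lift)
  then show ?thesis
    by (simp add: stopping_strategies_def stopping_times_def stopping_time_lift)
qed

section \<open>Discretized payoffs and the rewards of the tree game\<close>

definition mass :: "'a \<Rightarrow> real" where
  "mass x = prob (atom x)"

definition discrete_payoff :: "(ennreal \<Rightarrow> ennreal \<Rightarrow> 'a \<Rightarrow> real) \<Rightarrow> 'a strategy \<Rightarrow> 'a strategy \<Rightarrow> real" where
  "discrete_payoff V \<rho> \<tau> = (\<Sum>w\<in>W. mass w * V (realized \<rho> \<tau> w) (realized \<tau> \<rho> w) w)"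

lemma payoff_approx:
  assumes inv: "\<And>s t x y. x \<in> space M \<Longrightarrow> y \<in> space M \<Longrightarrow> indist M x y \<Longrightarrow> V s t y = V s t x"
    and bound: "\<And>s t x. x \<in> space M \<Longrightarrow> \<bar>V s t x\<bar> \<le> B"
    and \<rho>: "\<rho> \<in> stopping_strategies M F" and \<tau>: "\<tau> \<in> stopping_strategies M F"
  shows "\<bar>payoff M V \<rho> \<tau> - discrete_payoff V \<rho> \<tau>\<bar> \<le> B * prob (space M - (\<Union>w\<in>W. atom w))"
  unfolding payoff_def discrete_payoff_def mass_def
proof (rule integral_approx_finite_sum[OF finite_W W_space W_reps])
  fix x y assume xy: "x \<in> space M" "y \<in> space M" "indist M x y"
  show "V (realized \<rho> \<tau> y) (realized \<tau> \<rho> y) y = V (realized \<rho> \<tau> x) (realized \<tau> \<rho> x) x"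
    using inv[OF xy] realized_indist[OF \<rho> \<tau> xy] realized_indist[OF \<tau> \<rho> xy] by simp
qed (assumption | rule bound)+

lemma sum_mass_le_1: "sum mass W \<le> 1"
proof -
  have "disjoint_family_on atom W"
    unfolding disjoint_family_on_def
  proof (intro ballI impI)
    fix x y assume xy: "x \<in> W" "y \<in> W" "x \<noteq> y"
    have "z \<notin> atom y" if "z \<in> atom x" for z
      using W_reps[OF xy(1,2)] xy(3) that indist_trans[OF _ indist_sym, of M x z y] by (auto simp: atom_def)
    then show "atom x \<inter> atom y = {}" by blast
  qed
  then have "sum mass W = prob (\<Union>w\<in>W. atom w)"
    unfolding mass_def using finite_W by (intro finite_measure_finite_Union[symmetric]) auto
  then show ?thesis by simp
qed

text \<open>The player's own time is the first argument of \<open>V\<close>. The mass is part of the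
  reward, so that plain sums over an event compare conditional expectations on it.\<close>

definition first_reward :: "(ennreal \<Rightarrow> ennreal \<Rightarrow> 'a \<Rightarrow> real) \<Rightarrow> (nat \<Rightarrow> 'a \<Rightarrow> nat) \<Rightarrow> nat \<Rightarrow> 'a \<Rightarrow> real" where
  "first_reward V \<phi> a x = mass x * V (g a) (g (\<phi> a x)) x"

definition second_reward :: "(ennreal \<Rightarrow> ennreal \<Rightarrow> 'a \<Rightarrow> real) \<Rightarrow> (nat \<Rightarrow> 'a \<Rightarrow> nat) \<Rightarrow> nat \<Rightarrow> 'a \<Rightarrow> real" where
  "second_reward V \<psi> b x = mass x * V (g (\<psi> b x)) (g b) x"

text \<open>The last clause covers the case in which nobody stops: both players are then realized at \<open>\<infinity>\<close>.\<close>

definition best_reaction :: "(ennreal \<Rightarrow> ennreal \<Rightarrow> 'a \<Rightarrow> real) \<Rightarrow> (nat \<Rightarrow> 'a \<Rightarrow> nat) \<Rightarrow> bool" where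
  "best_reaction V \<psi> \<longleftrightarrow> (\<forall>b<N. adapted (Suc b) (\<psi> b) \<and>
     (\<forall>C \<kappa>. saturated b C \<longrightarrow> adapted (Suc b) \<kappa> \<longrightarrow>
       (\<Sum>x\<in>C. mass x * V (g (\<kappa> x)) (g b) x) \<le> (\<Sum>x\<in>C. second_reward V \<psi> b x))) \<and>
     \<psi> N = (\<lambda>_. N)"

text \<open>For fixed \<open>b\<close> this is a one-person problem, solved by
  \<open>optimal_adapted\<close> on all events of stage \<open>b\<close> simultaneously. That is
  needed because the event on which the opponent stops first depends on both first stopping
  times.\<close>

lemma best_reaction_exists:
  obtains \<psi> where "best_reaction V \<psi>"
proof -
  define opt where "opt b \<kappa> \<longleftrightarrow> adapted (Suc b) \<kappa> \<and>
     (\<forall>C \<kappa>'. saturated b C \<longrightarrow> adapted (Suc b) \<kappa>' \<longrightarrow>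
       (\<Sum>x\<in>C. mass x * V (g (\<kappa>' x)) (g b) x) \<le> (\<Sum>x\<in>C. mass x * V (g (\<kappa> x)) (g b) x))" for b \<kappa>
  define \<psi> where "\<psi> b = (if b = N then \<lambda>_. N else SOME \<kappa>. opt b \<kappa>)" for b
  have "opt b (\<psi> b)" if "b < N" for b
  proof -
    from that have "Suc b \<le> N" by simp
    from optimal_adapted[OF this, of "\<lambda>j x. mass x * V (g j) (g b) x"]
    have "\<exists>\<kappa>. opt b \<kappa>" unfolding opt_def by (meson le_SucI order_refl)
    from someI_ex[OF this] show ?thesis using that by (simp add: \<psi>_def)
  qed
  then have "best_reaction V \<psi>"
    by (simp add: best_reaction_def second_reward_def opt_def) (simp add: \<psi>_def)
  then show thesis by (rule that)
qed

text \<open>Rounding preserves the order of the stops: \<beta> stops at grid points, so the rounded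
  time of \<rho> is below \<beta> exactly when \<rho> stops strictly first.\<close>

lemma first_realized:
  assumes \<beta>: "adapted 0 \<beta>" and \<phi>: "\<And>k. k < N \<Longrightarrow> adapted (Suc k) (\<phi> k)"
    and w: "w \<in> W" and lt: "idx (fst \<rho> w) < \<beta> w"
  shows "realized \<rho> (lift \<beta>, reaction \<phi>) w = fst \<rho> w"
    "realized (lift \<beta>, reaction \<phi>) \<rho> w = g (\<phi> (idx (fst \<rho> w)) w)"
proof -
  have "\<beta> w \<le> N" using \<beta> w by (simp add: adapted_def)
  then have lt': "fst \<rho> w < lift \<beta> w"
    using lt le_idx_iff[of "\<beta> w" "fst \<rho> w"] by (simp add: lift_on_W[OF \<beta> w] not_le[symmetric])
  have "idx (fst \<rho> w) < N" using lt \<open>\<beta> w \<le> N\<close> by simp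
  from lift_on_W[OF \<phi>[OF this] w] lt'
  show "realized \<rho> (lift \<beta>, reaction \<phi>) w = fst \<rho> w"
    "realized (lift \<beta>, reaction \<phi>) \<rho> w = g (\<phi> (idx (fst \<rho> w)) w)"
    by (simp_all add: realized_first realized_second reaction_def)
qed

lemma second_realized:
  assumes \<beta>: "adapted 0 \<beta>" and w: "w \<in> W" and le: "\<beta> w \<le> idx (fst \<rho> w)"
  shows "g (\<beta> w) \<le> fst \<rho> w" "realized (lift \<beta>, \<Phi>) \<rho> w = g (\<beta> w)"
    "realized \<rho> (lift \<beta>, \<Phi>) w = (if fst \<rho> w \<le> g (\<beta> w) then g (\<beta> w) else snd \<rho> (g (\<beta> w)) w)"
proof -
  have "\<beta> w \<le> N" using \<beta> w by (simp add: adapted_def)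
  then show le': "g (\<beta> w) \<le> fst \<rho> w" using le le_idx_iff by blast
  then show "realized (lift \<beta>, \<Phi>) \<rho> w = g (\<beta> w)"
    by (simp add: realized_first lift_on_W[OF \<beta> w])
  show "realized \<rho> (lift \<beta>, \<Phi>) w = (if fst \<rho> w \<le> g (\<beta> w) then g (\<beta> w) else snd \<rho> (g (\<beta> w)) w)"
    using le' by (auto simp: realized_first realized_second lift_on_W[OF \<beta> w] not_le)
qed

text \<open>There is no rounding error, since both first times are grid points. Ties occur only at
  \<open>N\<close>, where \<open>\<psi> N\<close> gives the reward at (\<infinity>, \<infinity>), so
  paying them as reactions changes nothing.\<close>

lemma discrete_payoff_equilibrium:
  assumes \<alpha>: "adapted 0 \<alpha>" and \<beta>: "adapted 0 \<beta>"
    and \<phi>: "\<And>k. k < N \<Longrightarrow> adapted (Suc k) (\<phi> k)" and \<psi>: "best_reaction V \<psi>"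
    and tie: "\<And>x. x \<in> W \<Longrightarrow> \<alpha> x = \<beta> x \<Longrightarrow> \<alpha> x = N"
  shows "discrete_payoff V (lift \<alpha>, reaction \<psi>) (lift \<beta>, reaction \<phi>)
    = (\<Sum>x\<in>W. stopper_reward (first_reward V \<phi>) (second_reward V \<psi>) (\<alpha> x) (\<beta> x) x)"
  unfolding discrete_payoff_def
proof (rule sum.cong[OF refl])
  fix w assume w: "w \<in> W"
  let ?\<rho> = "(lift \<alpha>, reaction \<psi>)" and ?\<tau> = "(lift \<beta>, reaction \<phi>)"
  have N: "\<alpha> w \<le> N" "\<beta> w \<le> N" using \<alpha> \<beta> w by (simp_all add: adapted_def)
  have idx: "idx (fst ?\<rho> w) = \<alpha> w" "idx (fst ?\<tau> w) = \<beta> w"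
    using N by (simp_all add: lift_on_W[OF \<alpha> w] lift_on_W[OF \<beta> w] idx_g)
  have \<psi>': "adapted (Suc k) (\<psi> k)" if "k < N" for k using \<psi> that by (simp add: best_reaction_def)
  consider "\<alpha> w < \<beta> w" | "\<beta> w < \<alpha> w" | "\<alpha> w = N" "\<beta> w = N" using tie[OF w] by fastforce
  then show "mass w * V (realized ?\<rho> ?\<tau> w) (realized ?\<tau> ?\<rho> w) w
      = stopper_reward (first_reward V \<phi>) (second_reward V \<psi>) (\<alpha> w) (\<beta> w) w"
  proof cases
    case 1
    then show ?thesis
      using first_realized[OF \<beta> \<phi> w, of ?\<rho>] idx
      by (simp add: stopper_reward_def first_reward_def lift_on_W[OF \<alpha> w] idx_g)
  next
    case 2
    then show ?thesis
      using first_realized[OF \<alpha> \<psi>' w, of ?\<tau>] idx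
      by (simp add: stopper_reward_def second_reward_def lift_on_W[OF \<beta> w] idx_g)
  next
    case 3
    then show ?thesis
      using \<psi> by (simp add: realized_first lift_on_W[OF \<alpha> w] lift_on_W[OF \<beta> w] stopper_reward_def
          second_reward_def best_reaction_def)
  qed
qed

text \<open>Where \<rho> is strictly first, its time is rounded down. Elsewhere its behaviour is
  replaced by an adapted reaction on the grid, which the best reaction dominates. Each outcome
  incurs only one of the two errors, and the masses sum to at most 1, so the total error is
  \<delta>.\<close>

lemma discrete_payoff_deviation:
  assumes cells: "\<And>w s s' t t'. w \<in> W \<Longrightarrow> same_cell (g ` {..N}) s s' \<Longrightarrow> same_cell (g ` {..N}) t t' \<Longrightarrow>
      \<bar>V s t w - V s' t' w\<bar> \<le> \<delta>" and "\<delta> \<ge> 0"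
    and \<beta>: "adapted 0 \<beta>" and \<phi>: "\<And>k. k < N \<Longrightarrow> adapted (Suc k) (\<phi> k)" and \<psi>: "best_reaction V \<psi>"
    and \<rho>: "\<rho> \<in> stopping_strategies M F"
  shows "discrete_payoff V \<rho> (lift \<beta>, reaction \<phi>)
    \<le> (\<Sum>x\<in>W. stopper_reward (first_reward V \<phi>) (second_reward V \<psi>) (idx (fst \<rho> x)) (\<beta> x) x) + \<delta>"
proof -
  let ?\<tau> = "(lift \<beta>, reaction \<phi>)"
  \<comment> \<open>This is \<rho> read as a reaction to a stop at \<open>g b\<close>. A
    simultaneous stop becomes the earliest reaction \<open>Suc b\<close>; at \<open>b = N\<close>
    the value matches \<open>\<psi> N\<close>.\<close>
  define \<kappa> where "\<kappa> b x = (if b = N then N else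
    if x \<in> {x \<in> W. fst \<rho> x \<le> g b} then Suc b else max (Suc b) (idx (snd \<rho> (g b) x)))" for b x
  have \<rho>0: "stopping_time F (fst \<rho>)" using strategiesD(1)[OF \<rho>] .
  have g_fin: "g b < \<infinity>" if "b < N" for b
    using g_less_iff[of b N] that g_infinity[of N] by simp
  have \<kappa>_adapted: "adapted (Suc b) (\<kappa> b)" if b: "b < N" for b
  proof -
    have "saturated (Suc b) {x \<in> W. fst \<rho> x \<le> g b}"
      unfolding saturated_def
    proof (intro conjI ballI subsetI)
      fix x y assume x: "x \<in> {x \<in> W. fst \<rho> x \<le> g b}" and y: "y \<in> cl (Suc b) x"
      have "fst \<rho> x \<le> g (Suc b)" using x g_mono[of b "Suc b"] by auto
      then have "fst \<rho> y = fst \<rho> x"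
        using x y W_space by (intro stopping_time_indist[OF \<rho>0, of x y "g (Suc b)"]) (auto simp: cl_def)
      then show "y \<in> {x \<in> W. fst \<rho> x \<le> g b}" using x y by (simp add: cl_def)
    qed auto
    moreover have "adapted (Suc b) (\<lambda>x. max (Suc b) (idx (snd \<rho> (g b) x)))"
      using adapted_max[OF adapted_idx[OF strategiesD(2)[OF \<rho> g_fin[OF b]]]] b by simp
    ultimately have "adapted (Suc b) (\<lambda>x. if x \<in> {x \<in> W. fst \<rho> x \<le> g b} then Suc b
        else max (Suc b) (idx (snd \<rho> (g b) x)))"
      using b by (intro adapted_paste[where k = "Suc b"] adapted_const) auto
    then show ?thesis using b by (simp add: \<kappa>_def[abs_def])
  qed
  define h where "h b x = mass x * V (g (\<kappa> b x)) (g b) x" for b x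
  let ?a = "\<lambda>x. idx (fst \<rho> x)"
  have pointwise: "mass w * V (realized \<rho> ?\<tau> w) (realized ?\<tau> \<rho> w) w
      \<le> stopper_reward (first_reward V \<phi>) h (?a w) (\<beta> w) w + mass w * \<delta>" if w: "w \<in> W" for w
  proof -
    have mass: "mass w \<ge> 0" by (simp add: mass_def)
    show ?thesis
    proof (cases "?a w < \<beta> w")
      case True
      have "V (fst \<rho> w) (g (\<phi> (?a w) w)) w \<le> V (g (?a w)) (g (\<phi> (?a w) w)) w + \<delta>"
        using cells[OF w same_cell_idx[of "fst \<rho> w"] same_cell_refl, of "g (\<phi> (?a w) w)"] by linarith
      from mult_left_mono[OF this mass] show ?thesis
        using True first_realized[OF \<beta> \<phi> w True] by (simp add: stopper_reward_def first_reward_def algebra_simps)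
    next
      case False
      let ?b = "\<beta> w"
      have b: "?b \<le> N" using \<beta> w by (simp add: adapted_def)
      note real = second_realized[OF \<beta> w]
      have le: "?b \<le> ?a w" using False by simp
      have "same_cell (g ` {..N}) (realized \<rho> ?\<tau> w) (g (\<kappa> ?b w))"
      proof (cases "?b = N")
        case True
        then have "g ?b = \<infinity>" by (simp add: g_infinity)
        then show ?thesis using real(3)[OF le] True by (simp add: \<kappa>_def)
      next
        case False
        then have bN: "?b < N" using b by simp
        show ?thesis
        proof (cases "fst \<rho> w \<le> g ?b")
          case True
          then show ?thesis using real(3)[OF le] False w same_cell_Suc by (simp add: \<kappa>_def)
        next
          case False
          have "g ?b < snd \<rho> (g ?b) w" using strategiesD(3)[OF \<rho> g_fin[OF bN]] w W_space by auto
          from same_cell_max_Suc_idx[OF this bN] show ?thesis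
            using real(3)[OF le] False bN by (simp add: \<kappa>_def)
        qed
      qed
      from cells[OF w this same_cell_refl, of "g ?b"]
      have "V (realized \<rho> ?\<tau> w) (g ?b) w \<le> V (g (\<kappa> ?b w)) (g ?b) w + \<delta>" by linarith
      from mult_left_mono[OF this mass] show ?thesis
        using False real(2)[OF le] by (simp add: stopper_reward_def h_def algebra_simps)
    qed
  qed
  define D where "D b = {x \<in> {x \<in> W. \<beta> x \<le> ?a x}. \<beta> x = b}" for b
  have group: "(\<Sum>x | x \<in> W \<and> \<beta> x \<le> ?a x. q (\<beta> x) x) = (\<Sum>b\<le>N. \<Sum>x\<in>D b. q b x)" for q :: "nat \<Rightarrow> 'a \<Rightarrow> real"
  proof -
    have "(\<Sum>x | x \<in> W \<and> \<beta> x \<le> ?a x. q (\<beta> x) x) = (\<Sum>b\<le>N. \<Sum>x\<in>D b. q (\<beta> x) x)"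
      unfolding D_def using finite_W \<beta> by (intro sum.group[symmetric]) (auto simp: adapted_def)
    also have "\<dots> = (\<Sum>b\<le>N. \<Sum>x\<in>D b. q b x)"
      by (intro sum.cong refl) (simp add: D_def)
    finally show ?thesis .
  qed
  \<comment> \<open>Stage \<open>b\<close> already decides whether \<beta> equals \<open>b\<close>
    and whether the rounded time of \<rho> is below \<open>b\<close>. Reactions to a stop at
    \<open>g b\<close> may therefore be compared on \<open>D b\<close>.\<close>
  have D_sat: "saturated b (D b)" for b
    unfolding saturated_def
  proof (intro conjI ballI subsetI)
    fix x y assume x: "x \<in> D b" and y: "y \<in> cl b x"
    have xW: "x \<in> W" "\<beta> x = b" "b \<le> ?a x" using x by (auto simp: D_def)
    have yW: "y \<in> W" "x \<in> cl b y" using cl_sym[OF xW(1) y] by auto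
    have "\<beta> y = b" using adapted_eq[OF \<beta> xW(1) _ y] xW(2) by simp
    moreover have "b \<le> ?a y"
      using adapted_eq[OF adapted_idx[OF \<rho>0] yW(1) _ yW(2)] xW(3) by (metis nat_le_linear)
    ultimately show "y \<in> D b" using yW by (simp add: D_def)
  qed (auto simp: D_def)
  have "(\<Sum>x\<in>D b. h b x) \<le> (\<Sum>x\<in>D b. second_reward V \<psi> b x)" if "b \<le> N" for b
  proof (cases "b = N")
    case True
    then show ?thesis using \<psi> by (simp add: h_def second_reward_def best_reaction_def \<kappa>_def)
  next
    case False
    then show ?thesis
      using \<psi> that D_sat[of b] \<kappa>_adapted[of b] unfolding best_reaction_def h_def by simp
  qed
  then have react: "(\<Sum>x | x \<in> W \<and> \<beta> x \<le> ?a x. h (\<beta> x) x) \<le> (\<Sum>x | x \<in> W \<and> \<beta> x \<le> ?a x. second_reward V \<psi> (\<beta> x) x)"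
    unfolding group by (rule sum_mono) simp
  have split: "(\<Sum>x\<in>W. stopper_reward X Y (?a x) (\<beta> x) x)
      = (\<Sum>x | x \<in> W \<and> ?a x < \<beta> x. X (?a x) x) + (\<Sum>x | x \<in> W \<and> \<beta> x \<le> ?a x. Y (\<beta> x) x)"
    for X Y :: "nat \<Rightarrow> 'a \<Rightarrow> real"
  proof -
    have "(\<Sum>x\<in>W. stopper_reward X Y (?a x) (\<beta> x) x) = (\<Sum>x\<in>W. if ?a x < \<beta> x then X (?a x) x else Y (\<beta> x) x)"
      by (simp add: stopper_reward_def)
    also have "\<dots> = (\<Sum>x\<in>W \<inter> {x. ?a x < \<beta> x}. X (?a x) x) + (\<Sum>x\<in>W \<inter> - {x. ?a x < \<beta> x}. Y (\<beta> x) x)"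
      by (rule sum.If_cases[OF finite_W])
    also have "W \<inter> {x. ?a x < \<beta> x} = {x \<in> W. ?a x < \<beta> x}" by auto
    also have "W \<inter> - {x. ?a x < \<beta> x} = {x \<in> W. \<beta> x \<le> ?a x}" by auto
    finally show ?thesis .
  qed
  have "discrete_payoff V \<rho> ?\<tau> \<le> (\<Sum>w\<in>W. stopper_reward (first_reward V \<phi>) h (?a w) (\<beta> w) w + mass w * \<delta>)"
    unfolding discrete_payoff_def by (intro sum_mono pointwise)
  also have "\<dots> = (\<Sum>w\<in>W. stopper_reward (first_reward V \<phi>) h (?a w) (\<beta> w) w) + sum mass W * \<delta>"
    by (simp add: sum.distrib sum_distrib_right)
  also have "sum mass W * \<delta> \<le> 1 * \<delta>"
    by (rule mult_right_mono[OF sum_mass_le_1 \<open>\<delta> \<ge> 0\<close>])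
  finally show ?thesis using react by (simp add: split)
qed

text \<open>Discarding the mass outside the chosen atoms is paid twice, once for each payoff; the
  rounding error \<delta> is paid only for the deviation.\<close>

lemma almost_no_profitable_deviation:
  assumes inv: "\<And>s t x y. x \<in> space M \<Longrightarrow> y \<in> space M \<Longrightarrow> indist M x y \<Longrightarrow> V s t y = V s t x"
    and bound: "\<And>s t x. x \<in> space M \<Longrightarrow> \<bar>V s t x\<bar> \<le> B"
    and cells: "\<And>w s s' t t'. w \<in> W \<Longrightarrow> same_cell (g ` {..N}) s s' \<Longrightarrow> same_cell (g ` {..N}) t t' \<Longrightarrow>
      \<bar>V s t w - V s' t' w\<bar> \<le> \<delta>" and "\<delta> \<ge> 0"
    and \<alpha>: "adapted 0 \<alpha>" and \<beta>: "adapted 0 \<beta>"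
    and \<phi>: "\<And>k. k < N \<Longrightarrow> adapted (Suc k) (\<phi> k)" and \<psi>: "best_reaction V \<psi>"
    and tie: "\<And>x. x \<in> W \<Longrightarrow> \<alpha> x = \<beta> x \<Longrightarrow> \<alpha> x = N"
    and best: "best_against (first_reward V \<phi>) (second_reward V \<psi>) 0 \<alpha> \<beta>"
    and \<rho>: "\<rho> \<in> stopping_strategies M F"
  shows "payoff M V \<rho> (lift \<beta>, reaction \<phi>) \<le> payoff M V (lift \<alpha>, reaction \<psi>) (lift \<beta>, reaction \<phi>)
    + \<delta> + 2 * (B * prob (space M - (\<Union>w\<in>W. atom w)))"
proof -
  let ?\<rho> = "(lift \<alpha>, reaction \<psi>)" and ?\<tau> = "(lift \<beta>, reaction \<phi>)"
  let ?H = "\<lambda>\<alpha>. \<Sum>x\<in>W. stopper_reward (first_reward V \<phi>) (second_reward V \<psi>) (\<alpha> x) (\<beta> x) x"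
  have \<rho>': "?\<rho> \<in> stopping_strategies M F" and \<tau>': "?\<tau> \<in> stopping_strategies M F"
    using \<phi> \<psi> by (simp_all add: best_reaction_def strategy_in_strategies)
  have "saturated 0 W" using cl_subset by (simp add: saturated_def)
  then have "?H (\<lambda>x. idx (fst \<rho> x)) \<le> ?H \<alpha>"
    using best adapted_idx[OF strategiesD(1)[OF \<rho>]] by (simp add: best_against_def)
  moreover have "discrete_payoff V \<rho> ?\<tau> \<le> ?H (\<lambda>x. idx (fst \<rho> x)) + \<delta>"
    using cells \<open>\<delta> \<ge> 0\<close> \<beta> \<phi> \<psi> \<rho> by (rule discrete_payoff_deviation)
  moreover have "discrete_payoff V ?\<rho> ?\<tau> = ?H \<alpha>"
    using \<alpha> \<beta> \<phi> \<psi> tie by (rule discrete_payoff_equilibrium)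
  moreover have "\<bar>payoff M V \<rho> ?\<tau> - discrete_payoff V \<rho> ?\<tau>\<bar> \<le> B * prob (space M - (\<Union>w\<in>W. atom w))"
    using inv bound \<rho> \<tau>' by (rule payoff_approx)
  moreover have "\<bar>payoff M V ?\<rho> ?\<tau> - discrete_payoff V ?\<rho> ?\<tau>\<bar> \<le> B * prob (space M - (\<Union>w\<in>W. atom w))"
    using inv bound \<rho>' \<tau>' by (rule payoff_approx)
  ultimately show ?thesis by linarith
qed

end

section \<open>Choice of the grid and splitting of the error\<close>

theorem theorem2p4:
  fixes M :: "'a measure" and F :: "ennreal \<Rightarrow> 'a measure"
    and U :: "nat \<Rightarrow> ennreal \<Rightarrow> ennreal \<Rightarrow> 'a \<Rightarrow> real"
    and r :: "ennreal \<Rightarrow> real" and \<epsilon> :: real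
  assumes space: "countable_filtered_prob_space M F"
    and reward: "\<And>i. i \<in> {1, 2} \<Longrightarrow> reward_process M F (U i)"
    and r_nonneg: "\<And>h. 0 \<le> r h"
    and r_bounded: "bounded (range r)"
    and r_mono: "mono r"
    and r_lim: "(r \<longlongrightarrow> 0) (at_right 0)"
    and r_zero: "r 0 = 0"
    and modulus: "\<And>i s t s' t' \<omega>. i \<in> {1, 2} \<Longrightarrow> \<omega> \<in> space M \<Longrightarrow>
        \<bar>U i s t \<omega> - U i s' t' \<omega>\<bar> \<le> r (time_dist s s' + time_dist t t')"
    and eps: "\<epsilon> > 0"
  shows "\<exists>\<rho>s \<in> stopping_strategies M F. \<exists>\<tau>s \<in> stopping_strategies M F.
    \<forall>\<rho> \<in> stopping_strategies M F. \<forall>\<tau> \<in> stopping_strategies M F.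
      payoff M (U 1) \<rho> \<tau>s \<le> payoff M (U 1) \<rho>s \<tau>s + \<epsilon> \<and>
      payoff M (U 2) \<rho>s \<tau> \<le> payoff M (U 2) \<rho>s \<tau>s + \<epsilon>"
proof -
  interpret countable_filtered_prob_space M F by (rule space)
  obtain B1 where B1: "\<And>s t \<omega>. \<omega> \<in> space M \<Longrightarrow> \<bar>U 1 s t \<omega>\<bar> \<le> B1"
    using reward_process_bounded[OF reward r_bounded modulus] by (metis insertI1)
  obtain B2 where B2: "\<And>s t \<omega>. \<omega> \<in> space M \<Longrightarrow> \<bar>U 2 s t \<omega>\<bar> \<le> B2"
    using reward_process_bounded[OF reward r_bounded modulus] by (metis insertCI)
  \<comment> \<open>The maximum with 1 makes \<open>B\<close> positive, as the bound on the
    discarded mass divides by it.\<close>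
  define B where "B = max 1 (max B1 B2)"
  have B: "\<bar>U i s t \<omega>\<bar> \<le> B" if "i \<in> {1, 2}" "\<omega> \<in> space M" for i s t \<omega>
    using B1[OF that(2), of s t] B2[OF that(2), of s t] that(1) by (auto simp: B_def)
  have "B > 0" by (simp add: B_def)
  \<comment> \<open>Half of \<epsilon> goes to the variation inside cells; the other half covers two
    payoff approximations with error below \<epsilon> / 4 each.\<close>
  have "\<epsilon> / (4 * B) > 0" using eps \<open>B > 0\<close> by simp
  from finite_representatives[OF this] obtain W where W: "finite W" "W \<subseteq> space M"
      "\<forall>x\<in>W. \<forall>y\<in>W. indist M x y \<longrightarrow> x = y"
    and rest: "prob (space M - (\<Union>w\<in>W. atom w)) < \<epsilon> / (4 * B)"
    by blast
  have "\<epsilon> / 2 > 0" using eps by simp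
  define good where "good i w H \<longleftrightarrow> finite H \<and> (\<forall>s s' t t'. same_cell H s s' \<longrightarrow> same_cell H t t' \<longrightarrow>
    \<bar>U i s t w - U i s' t' w\<bar> \<le> \<epsilon> / 2)" for i w H
  define G where "G i w = (SOME H. good i w H)" for i w
  have good: "good i w (G i w)" if i: "i \<in> {1, 2}" and w: "w \<in> space M" for i w
  proof -
    from reward[OF i] have lims: "\<And>s. s < \<infinity> \<Longrightarrow> ((\<lambda>b. U i s b w) \<longlongrightarrow> U i s \<infinity> w) (at_left \<infinity>)"
      "\<And>t. t < \<infinity> \<Longrightarrow> ((\<lambda>a. U i a t w) \<longlongrightarrow> U i \<infinity> t w) (at_left \<infinity>)"
      "((\<lambda>(a, b). U i a b w) \<longlongrightarrow> U i \<infinity> \<infinity> w) (at_left \<infinity> \<times>\<^sub>F at_left \<infinity>)"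
      using w unfolding reward_process_def by blast+
    have "\<exists>H. good i w H" unfolding good_def
      by (rule uniform_cells) (fact lims modulus[OF i w] r_mono r_lim \<open>\<epsilon> / 2 > 0\<close>)+
    then show ?thesis unfolding G_def by (rule someI_ex)
  qed
  define K where "K = {0, \<infinity>} \<union> (\<Union>w\<in>W. G 1 w \<union> G 2 w) \<union> (\<Union>x\<in>W. separation_time x ` W)"
  have "finite K" "0 \<in> K" "\<infinity> \<in> K" using W(1,2) good by (auto simp: K_def good_def)
  then obtain g N where "time_grid g N" and K: "g ` {..N} = K" by (rule time_grid_exists)
  then interpret time_grid g N by simp
  interpret discretized_game M F g N W
  proof
    show "x = y" if "x \<in> W" "y \<in> W" "indist M x y" for x y
      using W(3) that by blast
    show "separation_time x y \<in> g ` {..N}" if "x \<in> W" "y \<in> W" for x y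
      unfolding K K_def using that by blast
  qed (fact W)+
  have cells: "\<bar>U i s t w - U i s' t' w\<bar> \<le> \<epsilon> / 2"
    if i: "i \<in> {1, 2}" and w: "w \<in> W" and "same_cell (g ` {..N}) s s'" "same_cell (g ` {..N}) t t'"
    for i w s s' t t'
  proof -
    have "G i w \<subseteq> g ` {..N}" using i w by (auto simp: K K_def)
    from same_cell_antimono[OF this that(3)] same_cell_antimono[OF this that(4)]
    have "same_cell (G i w) s s'" "same_cell (G i w) t t'" .
    moreover have "w \<in> space M" using w W(2) by auto
    ultimately show ?thesis using good[OF i] by (simp add: good_def)
  qed
  \<comment> \<open>Exchanging the arguments for player 2 puts each player's own time first, so one
    deviation bound serves both.\<close>
  define V1 V2 where "V1 = U 1" and "V2 = (\<lambda>s t. U 2 t s)"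
  obtain \<psi>1 where \<psi>1: "best_reaction V1 \<psi>1" by (rule best_reaction_exists)
  obtain \<psi>2 where \<psi>2: "best_reaction V2 \<psi>2" by (rule best_reaction_exists)
  have adapted_\<psi>: "\<And>k. k < N \<Longrightarrow> adapted (Suc k) (\<psi>1 k)" "\<And>k. k < N \<Longrightarrow> adapted (Suc k) (\<psi>2 k)"
    using \<psi>1 \<psi>2 by (simp_all add: best_reaction_def)
  \<comment> \<open>Stopping first triggers the opponent's reaction, hence \<psi>2 in the first
    reward of player 1 and \<psi>1 in that of player 2.\<close>
  obtain \<alpha> \<beta> where \<alpha>\<beta>: "adapted 0 \<alpha>" "adapted 0 \<beta>" and tie: "\<And>x. x \<in> W \<Longrightarrow> \<alpha> x = \<beta> x \<Longrightarrow> \<alpha> x = N"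
    and best: "best_against (first_reward V1 \<psi>2) (second_reward V1 \<psi>1) 0 \<alpha> \<beta>"
      "best_against (first_reward V2 \<psi>1) (second_reward V2 \<psi>2) 0 \<beta> \<alpha>"
    using discrete_equilibrium[OF le0, of "first_reward V1 \<psi>2" "second_reward V1 \<psi>1"
      "first_reward V2 \<psi>1" "second_reward V2 \<psi>2"] by blast
  have tie': "\<And>x. x \<in> W \<Longrightarrow> \<beta> x = \<alpha> x \<Longrightarrow> \<beta> x = N" using tie by fastforce
  let ?\<rho> = "(lift \<alpha>, reaction \<psi>1)" and ?\<tau> = "(lift \<beta>, reaction \<psi>2)"
  have err: "\<epsilon> / 2 + 2 * (B * prob (space M - (\<Union>w\<in>W. atom w))) \<le> \<epsilon>"
    using rest \<open>B > 0\<close> by (simp add: field_simps)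
  have dev1: "payoff M V1 \<rho> ?\<tau> \<le> payoff M V1 ?\<rho> ?\<tau> + \<epsilon> / 2 + 2 * (B * prob (space M - (\<Union>w\<in>W. atom w)))"
    if "\<rho> \<in> stopping_strategies M F" for \<rho>
  proof (rule almost_no_profitable_deviation)
    show "V1 s t y = V1 s t x" if "x \<in> space M" "y \<in> space M" "indist M x y" for s t x y
      unfolding V1_def by (rule reward_process_indist[OF reward that]) simp
    show "\<bar>V1 s t x\<bar> \<le> B" if "x \<in> space M" for s t x
      unfolding V1_def using that by (intro B) auto
    show "\<bar>V1 s t w - V1 s' t' w\<bar> \<le> \<epsilon> / 2" if "w \<in> W" "same_cell (g ` {..N}) s s'" "same_cell (g ` {..N}) t t'" for w s s' t t'
      unfolding V1_def using that by (intro cells) auto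
  qed (fact \<alpha>\<beta> adapted_\<psi> \<psi>1 best(1) that tie | simp add: eps less_imp_le)+
  have dev2: "payoff M V2 \<tau> ?\<rho> \<le> payoff M V2 ?\<tau> ?\<rho> + \<epsilon> / 2 + 2 * (B * prob (space M - (\<Union>w\<in>W. atom w)))"
    if "\<tau> \<in> stopping_strategies M F" for \<tau>
  proof (rule almost_no_profitable_deviation)
    show "V2 s t y = V2 s t x" if "x \<in> space M" "y \<in> space M" "indist M x y" for s t x y
      unfolding V2_def by (rule reward_process_indist[OF reward that]) simp
    show "\<bar>V2 s t x\<bar> \<le> B" if "x \<in> space M" for s t x
      unfolding V2_def using that by (intro B) auto
    show "\<bar>V2 s t w - V2 s' t' w\<bar> \<le> \<epsilon> / 2" if "w \<in> W" "same_cell (g ` {..N}) s s'" "same_cell (g ` {..N}) t t'" for w s s' t t'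
      unfolding V2_def using that by (intro cells) auto
  qed (fact \<alpha>\<beta> adapted_\<psi> \<psi>2 best(2) that tie' | simp add: eps less_imp_le)+
  have swap: "payoff M (U 2) \<rho> \<tau> = payoff M V2 \<tau> \<rho>" for \<rho> \<tau>
    by (simp add: payoff_def V2_def)
  show ?thesis
  proof (rule bexI[of _ ?\<rho>], rule bexI[of _ ?\<tau>], intro ballI conjI)
    fix \<rho> \<tau> assume \<rho>\<tau>: "\<rho> \<in> stopping_strategies M F" "\<tau> \<in> stopping_strategies M F"
    show "payoff M (U 1) \<rho> ?\<tau> \<le> payoff M (U 1) ?\<rho> ?\<tau> + \<epsilon>"
      using dev1[OF \<rho>\<tau>(1)] err by (simp add: V1_def)
    show "payoff M (U 2) ?\<rho> \<tau> \<le> payoff M (U 2) ?\<rho> ?\<tau> + \<epsilon>"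
      unfolding swap using dev2[OF \<rho>\<tau>(2)] err by simp
  qed (rule strategy_in_strategies, fact adapted_\<psi>)+
qed

end
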